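(* Let $\Delta$ satisfy a finite-horizon IQC with terminal cost matrix $Z=Z^T$ (with respect to the factorization $\Pi=\Psi^*M\Psi$), and suppose that there exists a real symmetric matrix $\mathcal X=\mathcal X^T$ with $$\begin{pmatrix} I&0\\ \mathcal A&\mathcal B\\ \mathcal C&\mathcal D\end{pmatrix}^T\begin{pmatrix}0&\mathcal X&0\\ \mathcal X&0&0\\ 0&0&M\end{pmatrix}\begin{pmatrix} I&0\\ \mathcal A&\mathcal B\\ \mathcal C&\mathcal D\end{pmatrix}\prec 0$$ which is coupled with $Z$ as $$\begin{pmatrix}\mathcal X_{11}-Z&\mathcal X_{12}\\ \mathcal X_{21}&\mathcal X_{22}\end{pmatrix}\succ 0 .$$ Then there exists some $\gamma>0$ such that $$\begin{pmatrix}\xi(T)\\ x(T)\end{pmatrix}^T\begin{pmatrix}\mathcal X_{11}-Z&\mathcal X_{12}\\ \mathcal X_{21}&\mathcal X_{22}\end{pmatrix}\begin{pmatrix}\xi(T)\\ x(T)\end{pmatrix}+\int_0^T \frac1\gamma\|z(t)\|^2-\gamma\|d(t)\|^2\,dt\le 0\quad\text{for all } T>0$$ holds along the trajectory of the filter $\Psi$ driven by any response $u=\mathrm{col}(z,w)$ of the feedback interconnection $z=Gw+d$, $w=\Delta(z)$ to any disturbance $d\in L_{2e}^{n_z}$ (here $\xi$ is the state of the filter and $x$ is the state of $G$ driven by $w$). Moreover, $d\in L_2^{n_z}$ implies $z\in L_2^{n_z}$ as well as $\|z\|\le\gamma\|d\|$ for all responses of this interconnection.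
   Context: $L_{2e}^n$ is the space of locally square integrable signals $[0,\infty)\to\mathbb R^n$; $L_2^n\subset L_{2e}^n$ is the subspace of signals with finite norm $\|x\|=\sqrt{\int_0^\infty x(t)^Tx(t)\,dt}$. For $T>0$, $P_T$ truncates a signal: $P_Tx=x$ on $[0,T]$ and $P_Tx=0$ on $(T,\infty)$. A system $S$ between such spaces is causal if $SP_T$ satisfies $P_TSP_T=P_TS$ for all $T>0$. $\prec,\succ$ refer to definiteness of symmetric matrices, and $\mathrm{col}$ stacks vectors. System: $G$ is the linear time-invariant system $\dot x=Ax+Bw$, $x(0)=0$, $z=Cx+Dw$, mapping $w\in L_{2e}^{n_w}$ to $z\in L_{2e}^{n_z}$ (real matrices; neither $G$ nor $\Delta$ is required to be stable for this result). Uncertainty: $\Delta:L_{2e}^{n_z}\to L_{2e}^{n_w}$ is a causal (possibly nonlinear) system. A response of the interconnection to $d\in L_{2e}^{n_z}$ is a pair $(z,w)\in L_{2e}^{n_z}\times L_{2e}^{n_w}$ with $z=Gw+d$, $w=\Delta(z)$; no well-posedness (existence or uniqueness of responses) is assumed. Multiplier and filter: $\Pi=\Psi^*M\Psi$, where $\Psi^*(s)=\Psi(-s)^T$, $M=M^T\in\mathbb R^{n_y\times n_y}$ and $\Psi$ is a stable proper real rational $n_y\times(n_z+n_w)$ transfer matrix with state-space realization (the filter) $\dot\xi=A_\Psi\xi+B_\Psi u$, $\xi(0)=0$, $y=C_\Psi\xi+D_\Psi u$, with $A_\Psi$ Hurwitz. Finite-horizon IQC: $\Delta$ satisfies a finite-horizon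 IQC with terminal cost matrix $Z=Z^T$ (with respect to $\Pi=\Psi^*M\Psi$) if $\int_0^T y(t)^TMy(t)\,dt+\xi(T)^TZ\xi(T)\ge 0$ for all $T>0$ holds for the trajectories of the filter driven by $u=\mathrm{col}(z,\Delta(z))$ with any $z\in L_{2e}^{n_z}$. With $C_F=\begin{pmatrix}C\\ 0\end{pmatrix}$, $D_F=\begin{pmatrix}D\\ I_{n_w}\end{pmatrix}$ put $$\mathcal A=\begin{pmatrix}A_\Psi&B_\Psi C_F\\ 0&A\end{pmatrix},\quad \mathcal B=\begin{pmatrix}B_\Psi D_F\\ B\end{pmatrix},\quad \mathcal C=\begin{pmatrix}C_\Psi&D_\Psi C_F\end{pmatrix},\quad \mathcal D=D_\Psi D_F .$$ $\mathcal X$ is partitioned into $2\times2$ blocks $\mathcal X_{ij}$ conformably with $\mathcal A$. *)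

theory Defs
  imports "HOL-Analysis.Analysis"
begin

section \<open>Signals and causal systems\<close>

text \<open>A signal on \<open>[0,\<infinity>)\<close> is represented by a function on \<^typ>\<open>real\<close> whose values at
  negative times are irrelevant. Elements of the signal spaces are classes modulo null sets, so
  equality of signals is \<open>sig_eq\<close> and an operator has to respect it.\<close>

definition sig_eq :: "(real \<Rightarrow> real^'n) \<Rightarrow> (real \<Rightarrow> real^'n) \<Rightarrow> bool" where
  "sig_eq x y \<longleftrightarrow> (AE t in lebesgue_on {0..}. x t = y t)"

definition L2e :: "(real \<Rightarrow> real^'n) set" where
  "L2e = {x. x \<in> borel_measurable (lebesgue_on {0..}) \<and>
             (\<forall>T>0. set_integrable lebesgue {0..T} (\<lambda>t. x t \<bullet> x t))}"

definition L2 :: "(real \<Rightarrow> real^'n) set" where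
  "L2 = {x \<in> L2e. set_integrable lebesgue {0..} (\<lambda>t. x t \<bullet> x t)}"

definition L2_norm :: "(real \<Rightarrow> real^'n) \<Rightarrow> real" where
  "L2_norm x = sqrt (LINT t:{0..}|lebesgue. x t \<bullet> x t)"

definition trunc :: "real \<Rightarrow> (real \<Rightarrow> real^'n) \<Rightarrow> (real \<Rightarrow> real^'n)" where
  "trunc T x = (\<lambda>t. if 0 \<le> t \<and> t \<le> T then x t else 0)"

definition system_on_L2e :: "((real \<Rightarrow> real^'m) \<Rightarrow> (real \<Rightarrow> real^'n)) \<Rightarrow> bool" where
  "system_on_L2e S \<longleftrightarrow>
     (\<forall>u\<in>L2e. S u \<in> L2e) \<and> (\<forall>u\<in>L2e. \<forall>v\<in>L2e. sig_eq u v \<longrightarrow> sig_eq (S u) (S v))"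

definition causal :: "((real \<Rightarrow> real^'m) \<Rightarrow> (real \<Rightarrow> real^'n)) \<Rightarrow> bool" where
  "causal S \<longleftrightarrow> (\<forall>T>0. \<forall>u\<in>L2e. sig_eq (trunc T (S (trunc T u))) (trunc T (S u)))"

section \<open>Block vectors and block matrices\<close>

definition col :: "real^'a \<Rightarrow> real^'b \<Rightarrow> real^('a::finite + 'b::finite)" where
  "col x y = (\<chi> i. case i of Inl a \<Rightarrow> x $ a | Inr b \<Rightarrow> y $ b)"

definition hcat :: "real^'a^'m \<Rightarrow> real^'b^'m \<Rightarrow> real^('a::finite + 'b::finite)^'m" where
  "hcat P Q = (\<chi> i. col (P $ i) (Q $ i))"

definition vcat :: "real^'n^'a \<Rightarrow> real^'n^'b \<Rightarrow> real^'n^('a::finite + 'b::finite)" where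
  "vcat P Q = (\<chi> i. case i of Inl a \<Rightarrow> P $ a | Inr b \<Rightarrow> Q $ b)"

definition blk11 :: "real^('k::finite + 'n::finite)^('k + 'n) \<Rightarrow> real^'k^'k" where
  "blk11 X = (\<chi> i j. X $ Inl i $ Inl j)"

definition blk12 :: "real^('k::finite + 'n::finite)^('k + 'n) \<Rightarrow> real^'n^'k" where
  "blk12 X = (\<chi> i j. X $ Inl i $ Inr j)"

definition blk21 :: "real^('k::finite + 'n::finite)^('k + 'n) \<Rightarrow> real^'k^'n" where
  "blk21 X = (\<chi> i j. X $ Inr i $ Inl j)"

definition blk22 :: "real^('k::finite + 'n::finite)^('k + 'n) \<Rightarrow> real^'n^'n" where
  "blk22 X = (\<chi> i j. X $ Inr i $ Inr j)"

definition symmetric_mat :: "real^'n^'n \<Rightarrow> bool" where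
  "symmetric_mat Q \<longleftrightarrow> transpose Q = Q"

definition pos_def :: "real^'n^'n \<Rightarrow> bool" where
  "pos_def Q \<longleftrightarrow> symmetric_mat Q \<and> (\<forall>v. v \<noteq> 0 \<longrightarrow> v \<bullet> (Q *v v) > 0)"

definition neg_def :: "real^'n^'n \<Rightarrow> bool" where
  "neg_def Q \<longleftrightarrow> symmetric_mat Q \<and> (\<forall>v. v \<noteq> 0 \<longrightarrow> v \<bullet> (Q *v v) < 0)"

definition hurwitz :: "real^'n^'n \<Rightarrow> bool" where
  "hurwitz A \<longleftrightarrow>
     (\<forall>l::complex. \<forall>v::complex^'n.
        v \<noteq> 0 \<and> (\<chi> i j. complex_of_real (A $ i $ j)) *v v = l *s v \<longrightarrow> Re l < 0)"

section \<open>Linear time-invariant systems\<close>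

text \<open>\<open>state_traj A B u x\<close>: \<open>x\<close> is the Caratheodory solution of \<open>x' = A x + B u\<close>, \<open>x(0) = 0\<close>, on
  \<open>[0,\<infinity>)\<close>. The input is only locally square integrable, so the differential equation is
  written in its integrated form.\<close>

definition state_traj ::
  "real^'n^'n \<Rightarrow> real^'m^'n \<Rightarrow> (real \<Rightarrow> real^'m) \<Rightarrow> (real \<Rightarrow> real^'n) \<Rightarrow> bool" where
  "state_traj A B u x \<longleftrightarrow>
     continuous_on {0..} x \<and>
     (\<forall>t\<ge>0. x t = (LINT s:{0..t}|lebesgue. A *v x s + B *v u s))"

definition lti_output ::
  "real^'n^'n \<Rightarrow> real^'m^'n \<Rightarrow> real^'n^'p \<Rightarrow> real^'m^'p \<Rightarrow>
   (real \<Rightarrow> real^'m) \<Rightarrow> (real \<Rightarrow> real^'p) \<Rightarrow> bool" where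
  "lti_output A B C D u v \<longleftrightarrow>
     (\<exists>x. state_traj A B u x \<and> sig_eq v (\<lambda>t. C *v x t + D *v u t))"

definition response ::
  "real^'n^'n \<Rightarrow> real^'w^'n \<Rightarrow> real^'n^'z \<Rightarrow> real^'w^'z \<Rightarrow>
   ((real \<Rightarrow> real^'z) \<Rightarrow> (real \<Rightarrow> real^'w)) \<Rightarrow>
   (real \<Rightarrow> real^'z) \<Rightarrow> (real \<Rightarrow> real^'z) \<Rightarrow> (real \<Rightarrow> real^'w) \<Rightarrow> bool" where
  "response A B C D \<Delta> d z w \<longleftrightarrow>
     z \<in> L2e \<and> w \<in> L2e \<and>
     (\<exists>v\<in>L2e. lti_output A B C D w v \<and> sig_eq z (\<lambda>t. v t + d t)) \<and>
     sig_eq w (\<Delta> z)"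

definition finite_horizon_iqc ::
  "real^'k^'k \<Rightarrow> real^('z::finite + 'w::finite)^'k \<Rightarrow> real^'k^'y \<Rightarrow> real^('z + 'w)^'y \<Rightarrow> real^'y^'y \<Rightarrow> real^'k^'k \<Rightarrow>
   ((real \<Rightarrow> real^'z) \<Rightarrow> (real \<Rightarrow> real^'w)) \<Rightarrow> bool" where
  "finite_horizon_iqc A\<Psi> B\<Psi> C\<Psi> D\<Psi> M Z \<Delta> \<longleftrightarrow>
     (\<forall>z\<in>L2e. \<forall>u \<xi> y.
        u = (\<lambda>t. col (z t) (\<Delta> z t)) \<longrightarrow>
        state_traj A\<Psi> B\<Psi> u \<xi> \<longrightarrow>
        y = (\<lambda>t. C\<Psi> *v \<xi> t + D\<Psi> *v u t) \<longrightarrow>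
        (\<forall>T>0. (LINT t:{0..T}|lebesgue. y t \<bullet> (M *v y t)) + \<xi> T \<bullet> (Z *v \<xi> T) \<ge> 0))"

section \<open>The matrix inequalities\<close>

definition CF :: "real^'n^'z \<Rightarrow> real^'n^('z::finite + 'w::finite)" where
  "CF C = vcat C 0"

definition DF :: "real^'w^'z \<Rightarrow> real^'w^('z::finite + 'w::finite)" where
  "DF D = vcat D (mat 1)"

definition calA ::
  "real^'k^'k \<Rightarrow> real^('z::finite + 'w::finite)^'k \<Rightarrow> real^'n^'n \<Rightarrow> real^'n^'z \<Rightarrow> real^('k::finite + 'n::finite)^('k + 'n)" where
  "calA A\<Psi> B\<Psi> A C = vcat (hcat A\<Psi> (B\<Psi> ** CF C)) (hcat 0 A)"

definition calB ::
  "real^('z::finite + 'w::finite)^'k \<Rightarrow> real^'w^'n \<Rightarrow> real^'w^'z \<Rightarrow> real^'w^('k::finite + 'n::finite)" where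
  "calB B\<Psi> B D = vcat (B\<Psi> ** DF D) B"

definition calC ::
  "real^'k^'y \<Rightarrow> real^('z::finite + 'w::finite)^'y \<Rightarrow> real^'n^'z \<Rightarrow> real^('k::finite + 'n::finite)^'y" where
  "calC C\<Psi> D\<Psi> C = hcat C\<Psi> (D\<Psi> ** CF C)"

definition calD :: "real^('z::finite + 'w::finite)^'y \<Rightarrow> real^'w^'z \<Rightarrow> real^'w^'y" where
  "calD D\<Psi> D = D\<Psi> ** DF D"

definition lmi_outer ::
  "real^'s^'s \<Rightarrow> real^'w^'s \<Rightarrow> real^'s^'y \<Rightarrow> real^'w^'y \<Rightarrow> real^('s::finite + 'w::finite)^('s + 's + 'y::finite)" where
  "lmi_outer \<A> \<B> \<C> \<D> =
     vcat (hcat (mat 1) 0)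
    (vcat (hcat \<A> \<B>)
          (hcat \<C> \<D>))"

definition lmi_middle ::
  "real^'s^'s \<Rightarrow> real^'y^'y \<Rightarrow> real^('s::finite + 's + 'y::finite)^('s + 's + 'y)" where
  "lmi_middle X M =
     vcat (hcat 0 (hcat X 0))
    (vcat (hcat X (hcat 0 0))
          (hcat 0 (hcat 0 M)))"

definition coupling :: "real^('k::finite + 'n::finite)^('k + 'n) \<Rightarrow> real^'k^'k \<Rightarrow> real^('k + 'n)^('k + 'n)" where
  "coupling X Z = vcat (hcat (blk11 X - Z) (blk12 X)) (hcat (blk21 X) (blk22 X))"

end

theory Submission
  imports Defs
begin

text \<open>The interconnection is a linear system with state \<open>\<eta> = col \<xi> x\<close> and inputs \<open>w\<close>, \<open>d\<close>; for
  \<open>d = 0\<close> the matrix inequality bounds \<open>2 \<eta>\<^sup>T X \<eta>' + y\<^sup>T M y\<close> by \<open>- \<epsilon> (\<bar>\<eta>\<bar>\<^sup>2 + \<bar>w\<bar>\<^sup>2)\<close>. This margin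
  absorbs the terms mixing \<open>(\<eta>, w)\<close> with \<open>d\<close> and also \<open>\<bar>z\<bar>\<^sup>2 / \<gamma>\<close>, at the price of \<open>\<gamma> \<bar>d\<bar>\<^sup>2\<close>. Integrating
  over \<open>[0,T]\<close> and inserting the IQC for \<open>\<integral> y\<^sup>T M y\<close>, whose terminal cost turns \<open>X\<close> into the coupling
  matrix, gives the dissipation inequality; positivity of that matrix and \<open>T \<rightarrow> \<infinity>\<close> give the
  gain bound. For the gain bound a filter state has to be
  provided first; it is the sum of a Picard series.\<close>

section \<open>Integrals over compact intervals\<close>

lemma set_integrable_Icc_iff:
  fixes f :: "real \<Rightarrow> 'a::{banach, second_countable_topology}"
  shows "set_integrable lebesgue {a..b} f \<longleftrightarrow> integrable (lebesgue_on {a..b}) f"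
  by (simp add: set_integrable_def integrable_restrict_space)

lemma set_integral_Icc_eq:
  fixes f :: "real \<Rightarrow> 'a::{banach, second_countable_topology}"
  shows "(LINT t:{a..b}|lebesgue. f t) = integral\<^sup>L (lebesgue_on {a..b}) f"
  by (simp add: set_lebesgue_integral_def integral_restrict_space)

lemma finite_measure_lebesgue_on_Icc: "finite_measure (lebesgue_on {a..b::real})"
  by (rule finite_measure_lebesgue_on) simp

text \<open>Moves integrals with a variable upper limit to one fixed measure space, as Fubini on a
  square requires.\<close>

lemma integral_lebesgue_on_Icc_eq_indicator:
  fixes f :: "real \<Rightarrow> 'a::{banach, second_countable_topology}"
  assumes "b \<le> c"
  shows "integral\<^sup>L (lebesgue_on {a..b}) f
    = integral\<^sup>L (lebesgue_on {a..c}) (\<lambda>t. if t \<le> b then f t else 0)"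
proof -
  have "integral\<^sup>L (lebesgue_on {a..b}) f = (\<integral>t. indicator {a..b} t *\<^sub>R f t \<partial>lebesgue)"
    by (simp add: integral_restrict_space)
  also have "\<dots> = (\<integral>t. indicator {a..c} t *\<^sub>R (if t \<le> b then f t else 0) \<partial>lebesgue)"
    using assms by (intro Bochner_Integration.integral_cong) (auto simp: indicator_def)
  also have "\<dots> = integral\<^sup>L (lebesgue_on {a..c}) (\<lambda>t. if t \<le> b then f t else 0)"
    by (simp add: integral_restrict_space)
  finally show ?thesis .
qed

lemma integrable_lebesgue_on_if_le:
  fixes f :: "real \<Rightarrow> 'a::{banach, second_countable_topology}"
  assumes "integrable (lebesgue_on {a..c}) f"
  shows "integrable (lebesgue_on {a..c}) (\<lambda>t. if t \<le> b then f t else 0)"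
proof (rule Bochner_Integration.integrable_bound[OF assms])
  have [measurable]: "f \<in> borel_measurable (lebesgue_on {a..c})"
    using assms by simp
  have [measurable]: "(\<lambda>x. x) \<in> borel_measurable (lebesgue_on {a..c})"
    by (rule continuous_imp_measurable_on_sets_lebesgue) auto
  show "(\<lambda>t. if t \<le> b then f t else 0) \<in> borel_measurable (lebesgue_on {a..c})"
    by measurable
qed auto

lemma matrix_vector_mult_integral:
  fixes f :: "'a \<Rightarrow> real^'m" and P :: "real^'m^'n"
  assumes "integrable N f"
  shows "integrable N (\<lambda>t. P *v f t)"
    and "integral\<^sup>L N (\<lambda>t. P *v f t) = P *v integral\<^sup>L N f"
proof -
  have bl: "bounded_linear ((*v) P)"
    by (simp add: linear_linear)
  show "integrable N (\<lambda>t. P *v f t)"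
    by (rule integrable_bounded_linear[OF bl assms])
  show "integral\<^sup>L N (\<lambda>t. P *v f t) = P *v integral\<^sup>L N f"
    by (rule integral_bounded_linear[OF bl assms])
qed

lemma borel_measurable_matrix_vector_mult:
  fixes P :: "real^'m^'n"
  shows "f \<in> borel_measurable N \<Longrightarrow> (\<lambda>t. P *v f t) \<in> borel_measurable N"
  using borel_measurable_continuous_on[of "(*v) P" f N]
  by (simp add: linear_continuous_on linear_linear)

lemma symmetric_mat_inner:
  assumes "symmetric_mat Q"
  shows "x \<bullet> (Q *v y) = y \<bullet> (Q *v x)"
  using assms unfolding symmetric_mat_def
  by (metis dot_lmul_matrix inner_commute transpose_matrix_vector)

text \<open>The product rule for the merely absolutely continuous function \<open>\<eta>\<close> comes from Fubini: the
  integral of \<open>p s \<bullet> X p t\<close> over the square \<open>[0,T]\<^sup>2\<close> is split along the diagonal.\<close>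

lemma quadratic_form_indefinite_integral:
  fixes p \<eta> :: "real \<Rightarrow> real^'n"
  assumes p: "integrable (lebesgue_on {0..T}) p" and X: "symmetric_mat X" and T: "0 \<le> T"
    and \<eta>: "\<And>t. 0 \<le> t \<Longrightarrow> t \<le> T \<Longrightarrow> \<eta> t = integral\<^sup>L (lebesgue_on {0..t}) p"
  shows "integral\<^sup>L (lebesgue_on {0..T}) (\<lambda>t. 2 * (\<eta> t \<bullet> (X *v p t))) = \<eta> T \<bullet> (X *v \<eta> T)"
proof -
  define N where "N = lebesgue_on {0..T}"
  interpret finite_measure N
    unfolding N_def by (rule finite_measure_lebesgue_on_Icc)
  interpret pair_sigma_finite N N ..
  have pN: "integrable N p" using p by (simp add: N_def)
  then have [measurable]: "p \<in> borel_measurable N" by simp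
  have [measurable]: "(\<lambda>x. x) \<in> borel_measurable N"
    unfolding N_def by (rule continuous_imp_measurable_on_sets_lebesgue) auto
  define q where "q t = X *v p t" for t
  have qN: "integrable N q"
    unfolding q_def using matrix_vector_mult_integral(1)[OF pN] .
  then have [measurable]: "q \<in> borel_measurable N" by simp
  define h where "h = (\<lambda>(s,t). p s \<bullet> q t)"
  have h_meas[measurable]: "h \<in> borel_measurable (N \<Otimes>\<^sub>M N)"
    unfolding h_def by measurable
  have "integrable (N \<Otimes>\<^sub>M N) (\<lambda>(s,t). norm (p s) * norm (q t))"
    by (rule Fubini_integrable) (use pN qN in auto)
  then have h_int: "integrable (N \<Otimes>\<^sub>M N) h"
    by (rule Bochner_Integration.integrable_bound)
      (auto simp: h_def Cauchy_Schwarz_ineq2)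
  \<comment> \<open>The diagonal belongs to \<open>k\<close> only, so \<open>h = k + k'\<close>
    holds at every point.\<close>
  define k where "k = (\<lambda>(s,t). if s \<le> t then h (s,t) else 0)"
  define k' where "k' = (\<lambda>(s,t). if t < s then h (s,t) else 0)"
  have [measurable]: "k \<in> borel_measurable (N \<Otimes>\<^sub>M N)" "k' \<in> borel_measurable (N \<Otimes>\<^sub>M N)"
    unfolding k_def k'_def by measurable
  have k_int: "integrable (N \<Otimes>\<^sub>M N) k"
    by (rule Bochner_Integration.integrable_bound[OF h_int]) (auto simp: k_def)
  have k'_int: "integrable (N \<Otimes>\<^sub>M N) k'"
    by (rule Bochner_Integration.integrable_bound[OF h_int]) (auto simp: k'_def)
  have \<eta>N: "\<eta> t = integral\<^sup>L N (\<lambda>s. if s \<le> t then p s else 0)" if "t \<in> {0..T}" for t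
    using \<eta>[of t] that integral_lebesgue_on_Icc_eq_indicator[of t T 0 p] by (simp add: N_def)
  have ip: "integrable N (\<lambda>s. if s \<le> t then p s else 0)" for t
    unfolding N_def by (rule integrable_lebesgue_on_if_le[OF p])
  have spN: "space N = {0..T}" by (simp add: N_def)
  \<comment> \<open>With \<open>t\<close> fixed, the integral of \<open>p s\<close> over
    \<open>s \<le> t\<close> rebuilds \<open>\<eta> t\<close>.\<close>
  have "integral\<^sup>L (N \<Otimes>\<^sub>M N) k = (\<integral>t. (\<integral>s. k (s,t) \<partial>N) \<partial>N)"
    using integral_snd[of "\<lambda>s t. k (s,t)"] k_int by simp
  also have "\<dots> = (\<integral>t. \<eta> t \<bullet> q t \<partial>N)"
  proof (rule Bochner_Integration.integral_cong)
    fix t assume "t \<in> space N"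
    then have "\<eta> t \<bullet> q t = (\<integral>s. (if s \<le> t then p s else 0) \<bullet> q t \<partial>N)"
      using \<eta>N ip[of t] by (simp add: spN)
    also have "\<dots> = (\<integral>s. k (s,t) \<partial>N)"
      by (intro Bochner_Integration.integral_cong) (auto simp: k_def h_def)
    finally show "(\<integral>s. k (s,t) \<partial>N) = \<eta> t \<bullet> q t" ..
  qed simp
  finally have 1: "integral\<^sup>L (N \<Otimes>\<^sub>M N) k = (\<integral>t. \<eta> t \<bullet> q t \<partial>N)" .
  \<comment> \<open>On the other triangle \<open>t\<close> is integrated first. Symmetry of
    \<open>X\<close> turns the outcome into the same integral as for \<open>k\<close>, whence the
    factor 2.\<close>
  have "integral\<^sup>L (N \<Otimes>\<^sub>M N) k' = (\<integral>s. (\<integral>t. k' (s,t) \<partial>N) \<partial>N)"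
    using integral_fst'[OF k'_int] by simp
  also have "\<dots> = (\<integral>s. \<eta> s \<bullet> q s \<partial>N)"
  proof (rule Bochner_Integration.integral_cong)
    fix s assume s: "s \<in> space N"
    have "\<eta> s \<bullet> q s = p s \<bullet> (X *v \<eta> s)"
      unfolding q_def by (rule symmetric_mat_inner[OF X])
    also have "\<dots> = p s \<bullet> (\<integral>t. X *v (if t \<le> s then p t else 0) \<partial>N)"
      using s \<eta>N matrix_vector_mult_integral(2)[OF ip[of s], of X] by (simp add: spN)
    also have "\<dots> = (\<integral>t. p s \<bullet> (X *v (if t \<le> s then p t else 0)) \<partial>N)"
      using matrix_vector_mult_integral(1)[OF ip[of s], of X] by simp
    also have "\<dots> = (\<integral>t. k' (s,t) \<partial>N)"
    \<comment> \<open>The integrands differ only at \<open>t = s\<close>, because \<open>k'\<close>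
      uses the strict inequality; a single point is a null set.\<close>
    proof (rule integral_cong_AE)
      have "AE t in lebesgue. t \<noteq> s"
        by (intro AE_I'[of "{s}"]) auto
      then have "AE t in N. t \<noteq> s"
        unfolding N_def by (auto simp: AE_restrict_space_iff elim!: eventually_mono)
      then show "AE t in N. p s \<bullet> (X *v (if t \<le> s then p t else 0)) = k' (s,t)"
        by eventually_elim (auto simp: k'_def h_def q_def)
      show "(\<lambda>t. p s \<bullet> (X *v (if t \<le> s then p t else 0))) \<in> borel_measurable N"
        using matrix_vector_mult_integral(1)[OF ip[of s], of X] by simp
      show "(\<lambda>t. k' (s,t)) \<in> borel_measurable N"
        using s by measurable
    qed
    finally show "(\<integral>t. k' (s,t) \<partial>N) = \<eta> s \<bullet> q s" ..
  qed simp
  finally have 2: "integral\<^sup>L (N \<Otimes>\<^sub>M N) k' = (\<integral>t. \<eta> t \<bullet> q t \<partial>N)" .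
  have "integral\<^sup>L (N \<Otimes>\<^sub>M N) h = (\<integral>s. (\<integral>t. h (s,t) \<partial>N) \<partial>N)"
    using integral_fst'[OF h_int] by simp
  also have "\<dots> = (\<integral>s. p s \<bullet> (\<integral>t. q t \<partial>N) \<partial>N)"
    using qN by (simp add: h_def)
  also have "\<dots> = (\<integral>s. p s \<partial>N) \<bullet> (\<integral>t. q t \<partial>N)"
    using pN by simp
  also have "\<dots> = \<eta> T \<bullet> (X *v \<eta> T)"
    using \<eta>[of T] T matrix_vector_mult_integral(2)[OF pN, of X] by (simp add: q_def N_def)
  finally have 3: "integral\<^sup>L (N \<Otimes>\<^sub>M N) h = \<eta> T \<bullet> (X *v \<eta> T)" .
  have "h = (\<lambda>z. k z + k' z)"
    by (auto simp: h_def k_def k'_def)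
  then have "integral\<^sup>L (N \<Otimes>\<^sub>M N) h = 2 * (\<integral>t. \<eta> t \<bullet> q t \<partial>N)"
    using 1 2 k_int k'_int by simp
  then show ?thesis
    using 3 by (simp add: q_def N_def)
qed

section \<open>Linear Volterra equations\<close>

lemma continuous_on_atLeast_if_Icc:
  fixes f :: "real \<Rightarrow> 'a::topological_space"
  assumes "\<And>b. continuous_on {a..b} f"
  shows "continuous_on {a..} f"
  unfolding continuous_on_eq_continuous_within
proof
  fix x assume "x \<in> {a..}"
  then have "continuous (at x within {a..x + 1}) f"
    using assms[of "x + 1"] by (simp add: continuous_on_eq_continuous_within)
  moreover have "at x within {a..x + 1} = at x within {a..}"
    by (rule at_within_nhd[of x "{..<x + 1}"]) auto
  ultimately show "continuous (at x within {a..}) f"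
    by simp
qed

lemma matrix_norm_bound_pos:
  fixes P :: "real^'m^'n"
  obtains K where "K > 0" "\<And>v. norm (P *v v) \<le> K * norm v"
  using linear_bounded_pos[of "(*v) P"] by auto

lemma continuous_on_matrix_vector_mult:
  fixes P :: "real^'m^'n"
  assumes "continuous_on S f"
  shows "continuous_on S (\<lambda>t. P *v f t)"
  by (rule bounded_linear.continuous_on[OF matrix_vector_mul_bounded_linear assms])

text \<open>Induction: integrating \<open>K\<close> times the bound for \<open>k\<close> gives
  exactly the bound for \<open>Suc k\<close>. The sequence \<open>f\<close> is left general so that
  a constant sequence (uniqueness) and the Picard terms (existence) are both covered.\<close>

lemma iterated_integral_bound:
  fixes f :: "nat \<Rightarrow> real \<Rightarrow> real^'n" and P :: "real^'n^'n"
  assumes cont: "\<And>k. continuous_on {0..T} (f k)"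
    and step: "\<And>k t. 0 \<le> t \<Longrightarrow> t \<le> T \<Longrightarrow> f (Suc k) t = integral {0..t} (\<lambda>s. P *v f k s)"
    and G: "\<And>t. 0 \<le> t \<Longrightarrow> t \<le> T \<Longrightarrow> norm (f 0 t) \<le> G"
    and K: "\<And>v. norm (P *v v) \<le> K * norm v" "K \<ge> 0"
  shows "0 \<le> t \<Longrightarrow> t \<le> T \<Longrightarrow> norm (f k t) \<le> G * ((K * t) ^ k / fact k)"
proof (induction k arbitrary: t)
  case 0
  then show ?case using G by simp
next
  case (Suc k)
  have "((\<lambda>s. K * (G * ((K * s) ^ k / fact k))) has_integral
      G * ((K * t) ^ Suc k / fact (Suc k)) - G * ((K * 0) ^ Suc k / fact (Suc k))) {0..t}"
    using Suc.prems(1)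
  proof (rule fundamental_theorem_of_calculus)
    fix x assume "x \<in> {0..t}"
    have "((\<lambda>t. G * ((K * t) ^ Suc k / fact (Suc k))) has_real_derivative
        G * ((of_nat (Suc k) * (K * x) ^ k * K) / fact (Suc k))) (at x within {0..t})"
      by (auto intro!: derivative_eq_intros simp del: power_Suc of_nat_Suc)
    also have "G * ((of_nat (Suc k) * (K * x) ^ k * K) / fact (Suc k))
        = K * (G * ((K * x) ^ k / fact k))"
      by (simp del: of_nat_Suc)
    finally show "((\<lambda>t. G * ((K * t) ^ Suc k / fact (Suc k))) has_vector_derivative
        K * (G * ((K * x) ^ k / fact k))) (at x within {0..t})"
      by (simp add: has_real_derivative_iff_has_vector_derivative)
  qed
  then have bnd: "((\<lambda>s. K * (G * ((K * s) ^ k / fact k))) has_integral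
      G * ((K * t) ^ Suc k / fact (Suc k))) {0..t}"
    by simp
  have cont': "continuous_on {0..t} (\<lambda>s. P *v f k s)"
    by (rule continuous_on_subset[OF continuous_on_matrix_vector_mult[OF cont]])
      (use Suc.prems in auto)
  have "norm (f (Suc k) t) = norm (integral {0..t} (\<lambda>s. P *v f k s))"
    using step Suc.prems by simp
  also have "\<dots> \<le> integral {0..t} (\<lambda>s. K * (G * ((K * s) ^ k / fact k)))"
  proof (rule integral_norm_bound_integral)
    show "(\<lambda>s. P *v f k s) integrable_on {0..t}"
      by (rule integrable_continuous_real[OF cont'])
    show "(\<lambda>s. K * (G * ((K * s) ^ k / fact k))) integrable_on {0..t}"
      using bnd by blast
    fix s assume s: "s \<in> {0..t}"
    have "norm (P *v f k s) \<le> K * norm (f k s)" by (rule K)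
    also have "\<dots> \<le> K * (G * ((K * s) ^ k / fact k))"
      using Suc.IH[of s] Suc.prems s K(2) by (intro mult_left_mono) auto
    finally show "norm (P *v f k s) \<le> K * (G * ((K * s) ^ k / fact k))" .
  qed
  also have "\<dots> = G * ((K * t) ^ Suc k / fact (Suc k))"
    using bnd by (rule integral_unique)
  finally show ?case .
qed

text \<open>A solution reproduces itself under the integral operator, so the constant sequence
  \<open>\<lambda>_. e\<close> obeys the iterated bound for every \<open>k\<close>. The bound is a
  multiple of a term of the exponential series and tends to 0.\<close>

lemma linear_integral_equation_zero:
  fixes e :: "real \<Rightarrow> real^'n" and P :: "real^'n^'n"
  assumes cont: "continuous_on {0..} e"
    and e: "\<And>t. 0 \<le> t \<Longrightarrow> e t = integral {0..t} (\<lambda>s. P *v e s)"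
    and T: "0 \<le> T"
  shows "e T = 0"
proof -
  obtain K where K: "K > 0" "\<And>v. norm (P *v v) \<le> K * norm v"
    using matrix_norm_bound_pos[of P] by metis
  have cT: "continuous_on {0..T} e"
    by (rule continuous_on_subset[OF cont]) auto
  then have "bounded (e ` {0..T})"
    by (intro compact_imp_bounded compact_continuous_image) auto
  then obtain G where G: "\<And>t. t \<in> {0..T} \<Longrightarrow> norm (e t) \<le> G"
    unfolding bounded_iff by blast
  have "norm (e T) \<le> G * ((K * T) ^ k / fact k)" for k
    by (rule iterated_integral_bound[of T "\<lambda>_. e" P G K]) (use cT e G K T in auto)
  moreover have "(\<lambda>k. G * ((K * T) ^ k / fact k)) \<longlonglongrightarrow> G * 0"
    by (intro tendsto_mult tendsto_const summable_LIMSEQ_zero)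
      (use summable_exp[of "K * T"] in \<open>simp add: divide_inverse mult.commute\<close>)
  ultimately have "norm (e T) \<le> G * 0"
    by (intro LIMSEQ_le_const[of _ "G * 0" "norm (e T)"]) auto
  then show ?thesis by simp
qed

text \<open>These are the terms of the Neumann series, the \<open>k\<close>-th power of the Volterra
  operator applied to \<open>g\<close>; the usual Picard iterates are their partial sums.\<close>

primrec picard :: "real^'n^'n \<Rightarrow> (real \<Rightarrow> real^'n) \<Rightarrow> nat \<Rightarrow> real \<Rightarrow> real^'n" where
  "picard P g 0 = g"
| "picard P g (Suc k) = (\<lambda>t. integral {0..t} (\<lambda>s. P *v picard P g k s))"

lemma continuous_on_picard:
  assumes "continuous_on {0..} g"
  shows "continuous_on {0..} (picard P g k)"
proof (induction k)
  case 0
  then show ?case using assms by simp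
next
  case (Suc k)
  have "continuous_on {0..b} (picard P g (Suc k))" for b
    unfolding picard.simps
    by (intro indefinite_integral_continuous_1 integrable_continuous_real
        continuous_on_matrix_vector_mult continuous_on_subset[OF Suc.IH]) auto
  then show ?case by (rule continuous_on_atLeast_if_Icc)
qed

text \<open>The series of Picard terms is dominated on each compact interval by an exponential
  series, hence converges uniformly there. The limit is continuous, and the integral operator may be
  applied term by term, which shifts the series by one index.\<close>

lemma linear_integral_equation_solution:
  fixes g :: "real \<Rightarrow> real^'n" and P :: "real^'n^'n"
  assumes cont: "continuous_on {0..} g"
  obtains x where "continuous_on {0..} x"
    and "\<And>t. 0 \<le> t \<Longrightarrow> x t = g t + integral {0..t} (\<lambda>s. P *v x s)"
proof -
  obtain K where K: "K > 0" "\<And>v. norm (P *v v) \<le> K * norm v"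
    using matrix_norm_bound_pos[of P] by metis
  define x where "x t = (\<Sum>k. picard P g k t)" for t
  have cpic: "continuous_on {0..T} (picard P g k)" for T k
    by (rule continuous_on_subset[OF continuous_on_picard[OF cont]]) auto
  have ulim: "uniform_limit {0..T} (\<lambda>n t. \<Sum>k<n. picard P g k t) x sequentially" for T
  proof -
    have "bounded (g ` {0..T})"
      using cpic[of T 0] by (intro compact_imp_bounded compact_continuous_image) auto
    then obtain G where G: "\<And>t. t \<in> {0..T} \<Longrightarrow> norm (g t) \<le> G"
      unfolding bounded_iff by blast
    have bnd: "norm (picard P g k t) \<le> \<bar>G\<bar> * ((K * T) ^ k / fact k)" if "t \<in> {0..T}" for k t
    proof -
      have "norm (picard P g k t) \<le> G * ((K * t) ^ k / fact k)"
        by (rule iterated_integral_bound[of T "picard P g" P G K])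
          (use cpic G K that in auto)
      also have "\<dots> \<le> \<bar>G\<bar> * ((K * T) ^ k / fact k)"
        using that K by (intro mult_mono divide_right_mono power_mono) auto
      finally show ?thesis .
    qed
    have "summable (\<lambda>k. \<bar>G\<bar> * ((K * T) ^ k / fact k))"
      using summable_exp[of "K * T"] by (intro summable_mult) (simp add: divide_inverse mult.commute)
    then show ?thesis
      unfolding x_def using bnd by (intro Weierstrass_m_test) auto
  qed
  have cx: "continuous_on {0..T} x" for T
    by (rule uniform_limit_theorem[OF _ ulim[of T]])
      (auto intro!: always_eventually continuous_on_sum cpic)
  have "x t = g t + integral {0..t} (\<lambda>s. P *v x s)" if "0 \<le> t" for t
  proof -
    have "uniform_limit {0..t} (\<lambda>n s. P *v (\<Sum>k<n. picard P g k s)) (\<lambda>s. P *v x s) sequentially"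
      by (rule bounded_linear.uniform_limit[OF _ ulim]) (simp add: linear_linear)
    moreover have "continuous_on {0..t} (\<lambda>s. P *v (\<Sum>k<n. picard P g k s))" for n
      by (intro continuous_on_matrix_vector_mult continuous_on_sum cpic)
    ultimately obtain I J where
      I: "\<And>n. ((\<lambda>s. P *v (\<Sum>k<n. picard P g k s)) has_integral I n) {0..t}"
      and J: "((\<lambda>s. P *v x s) has_integral J) {0..t}" and IJ: "I \<longlonglongrightarrow> J"
      by (rule uniform_limit_integral) auto
    \<comment> \<open>Integrating a Picard term yields the next one, so only the zeroth term
      \<open>g t\<close> is missing from the longer partial sum.\<close>
    have "I n = (\<Sum>k<Suc n. picard P g k t) - g t" for n
    proof -
      have "((\<lambda>s. \<Sum>k<n. P *v picard P g k s) has_integral (\<Sum>k<n. picard P g (Suc k) t)) {0..t}"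
        by (intro has_integral_sum)
          (auto intro!: integrable_integral integrable_continuous_real
            continuous_on_matrix_vector_mult cpic)
      then have "((\<lambda>s. P *v (\<Sum>k<n. picard P g k s)) has_integral
          (\<Sum>k<n. picard P g (Suc k) t)) {0..t}"
        by (simp add: linear_sum[of "(*v) P"])
      then have "I n = (\<Sum>k<n. picard P g (Suc k) t)"
        using I[of n] has_integral_unique by blast
      then show ?thesis
        unfolding sum.lessThan_Suc_shift by simp
    qed
    moreover have "(\<lambda>n. \<Sum>k<n. picard P g k t) \<longlonglongrightarrow> x t"
      using tendsto_uniform_limitI[OF ulim[of t]] that by auto
    then have "(\<lambda>n. (\<Sum>k<Suc n. picard P g k t) - g t) \<longlonglongrightarrow> x t - g t"
      by (intro tendsto_diff tendsto_const) (rule LIMSEQ_Suc)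
    ultimately have "I \<longlonglongrightarrow> x t - g t" by presburger
    then have "J = x t - g t" using IJ LIMSEQ_unique by blast
    then show ?thesis using J by (simp add: integral_unique)
  qed
  with cx show thesis
    by (intro that[of x] continuous_on_atLeast_if_Icc) auto
qed

section \<open>Block matrices and the matrix inequality\<close>

lemma sum_UNIV_Plus:
  fixes f :: "'a::finite + 'b::finite \<Rightarrow> 'c::comm_monoid_add"
  shows "(\<Sum>i\<in>UNIV. f i) = (\<Sum>a\<in>UNIV. f (Inl a)) + (\<Sum>b\<in>UNIV. f (Inr b))"
  by (subst UNIV_Plus_UNIV[symmetric], subst sum.Plus) (simp_all add: comp_def)

lemma col_nth [simp]: "col x y $ Inl a = x $ a" "col x y $ Inr b = y $ b"
  by (simp_all add: col_def)

lemma col_eq_iff: "v = col x y \<longleftrightarrow> (\<forall>a. v $ Inl a = x $ a) \<and> (\<forall>b. v $ Inr b = y $ b)"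
  by (auto simp: vec_eq_iff col_def split: sum.split)

lemma inner_col: "col a b \<bullet> col c d = a \<bullet> c + b \<bullet> d"
  by (simp add: inner_vec_def sum_UNIV_Plus)

lemma norm_col: "(norm (col a b))\<^sup>2 = (norm a)\<^sup>2 + (norm b)\<^sup>2"
  by (simp add: power2_norm_eq_inner inner_col)

lemma col_add: "col a b + col c d = col (a + c) (b + d)"
  by (subst col_eq_iff) simp

lemma col_diff: "col a b - col c d = col (a - c) (b - d)"
  by (subst col_eq_iff) simp

lemma vcat_mult_vec: "vcat P Q *v x = col (P *v x) (Q *v x)"
  by (subst col_eq_iff) (simp add: vcat_def matrix_vector_mult_def)

lemma hcat_mult_col: "hcat P Q *v col x y = P *v x + Q *v y"
  by (simp add: vec_eq_iff hcat_def matrix_vector_mult_def sum_UNIV_Plus)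

lemma block_decomposition:
  "vcat (hcat (blk11 X) (blk12 X)) (hcat (blk21 X) (blk22 X)) = X"
  by (auto simp: vec_eq_iff vcat_def hcat_def blk11_def blk12_def blk21_def blk22_def col_def
      split: sum.split)

lemma coupling_mult_col: "coupling X Z *v col a b = X *v col a b - col (Z *v a) 0"
proof -
  have "X *v col a b = vcat (hcat (blk11 X) (blk12 X)) (hcat (blk21 X) (blk22 X)) *v col a b"
    by (simp only: block_decomposition)
  then show ?thesis
    by (simp add: coupling_def vcat_mult_vec hcat_mult_col col_diff
        matrix_vector_mult_diff_rdistrib algebra_simps)
qed

text \<open>The coupling matrix is \<open>X\<close> minus the block diagonal matrix of
  \<open>Z\<close> and 0. This is where the terminal cost of the IQC meets the storage function
  given by \<open>X\<close>.\<close>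

lemma coupling_quadratic_form:
  "col a b \<bullet> (coupling X Z *v col a b) = col a b \<bullet> (X *v col a b) - a \<bullet> (Z *v a)"
  by (simp add: coupling_mult_col inner_diff_right inner_col)

lemma CF_mult_vec: "CF C *v x = col (C *v x) 0"
  by (simp add: CF_def vcat_mult_vec)

lemma DF_mult_vec: "DF D *v w = col (D *v w) w"
  by (simp add: DF_def vcat_mult_vec)

lemma congruence_quadratic_form:
  fixes L :: "real^'m^'n"
  shows "u \<bullet> ((transpose L ** N ** L) *v u) = (L *v u) \<bullet> (N *v (L *v u))"
proof -
  have "u \<bullet> (transpose L *v y) = (L *v u) \<bullet> y" for y
    by (simp add: inner_commute[of u] inner_commute[of _ y] dot_lmul_matrix)
  then show ?thesis
    by (simp only: matrix_vector_mul_assoc[symmetric])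
qed

text \<open>The two off-diagonal blocks \<open>X\<close> contribute equal terms by symmetry. With
  \<open>\<eta>' = P \<eta> + Q w\<close> the first summand is the derivative of
  \<open>\<eta> \<bullet> (X *v \<eta>)\<close>, the second the integrand of the IQC.\<close>

lemma lmi_quadratic_form:
  assumes "symmetric_mat X"
  shows "col \<eta> w \<bullet> ((transpose (lmi_outer P Q R S) ** lmi_middle X M ** lmi_outer P Q R S) *v col \<eta> w)
    = 2 * (\<eta> \<bullet> (X *v (P *v \<eta> + Q *v w))) + (R *v \<eta> + S *v w) \<bullet> (M *v (R *v \<eta> + S *v w))"
proof -
  have outer: "lmi_outer P Q R S *v col \<eta> w
      = col \<eta> (col (P *v \<eta> + Q *v w) (R *v \<eta> + S *v w))"
    by (simp add: lmi_outer_def vcat_mult_vec hcat_mult_col)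
  have middle: "lmi_middle X M *v col a (col b c) = col (X *v b) (col (X *v a) (M *v c))"
    for a b c
    by (simp add: lmi_middle_def vcat_mult_vec hcat_mult_col)
  show ?thesis
    using symmetric_mat_inner[OF assms, of "P *v \<eta> + Q *v w" \<eta>]
    by (simp add: congruence_quadratic_form outer middle inner_col)
qed

section \<open>Strictness margin and robustness against a disturbance input\<close>

text \<open>The form attains its maximum on the compact unit sphere; this maximum is negative and,
  by homogeneity, \<open>- \<epsilon>\<close>.\<close>

lemma neg_def_uniform:
  fixes Q :: "real^'n^'n"
  assumes "neg_def Q"
  obtains \<epsilon> where "\<epsilon> > 0" "\<And>v. v \<bullet> (Q *v v) \<le> - \<epsilon> * (norm v)\<^sup>2"
proof -
  have "continuous_on (sphere 0 1) (\<lambda>v. v \<bullet> (Q *v v))"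
    by (intro continuous_on_inner continuous_on_matrix_vector_mult continuous_on_id)
  moreover have "sphere (0 :: real^'n) 1 \<noteq> {}"
    by simp
  ultimately obtain u :: "real^'n" where u: "norm u = 1"
    and max: "\<And>v :: real^'n. norm v = 1 \<Longrightarrow> v \<bullet> (Q *v v) \<le> u \<bullet> (Q *v u)"
    using continuous_attains_sup[of "sphere 0 1" "\<lambda>v. v \<bullet> (Q *v v)"]
    by (auto simp: dist_norm)
  show thesis
  proof
    show "- (u \<bullet> (Q *v u)) > 0"
      using assms u unfolding neg_def_def by (metis neg_0_less_iff_less norm_zero zero_neq_one)
    fix v :: "real^'n"
    show "v \<bullet> (Q *v v) \<le> - (- (u \<bullet> (Q *v u))) * (norm v)\<^sup>2"
    proof (cases "v = 0")
      case False
      define v' where "v' = v /\<^sub>R norm v"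
      have v: "v = norm v *\<^sub>R v'" and "norm v' = 1"
        using False by (simp_all add: v'_def)
      have "v \<bullet> (Q *v v) = (norm v)\<^sup>2 * (v' \<bullet> (Q *v v'))"
        by (subst (1 2) v) (simp add: matrix_vector_mult_scaleR power2_eq_square)
      also have "\<dots> \<le> (norm v)\<^sup>2 * (u \<bullet> (Q *v u))"
        using max[OF \<open>norm v' = 1\<close>] by (intro mult_left_mono) auto
      finally show ?thesis by (simp add: mult.commute)
    qed simp
  qed
qed

text \<open>The weights are chosen so that \<open>a\<close> costs half of the margin
  \<open>\<epsilon>\<close>.\<close>

lemma young_ineq:
  fixes a b \<epsilon> :: real
  assumes "\<epsilon> > 0"
  shows "a * b \<le> \<epsilon> / 2 * a\<^sup>2 + b\<^sup>2 / (2 * \<epsilon>)"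
proof -
  have "0 \<le> (\<epsilon> * a - b)\<^sup>2 / (2 * \<epsilon>)"
    using assms by simp
  also have "(\<epsilon> * a - b)\<^sup>2 / (2 * \<epsilon>) = \<epsilon> / 2 * a\<^sup>2 + b\<^sup>2 / (2 * \<epsilon>) - a * b"
    using assms by (simp add: power2_eq_square field_simps)
  finally show ?thesis by simp
qed

text \<open>\<open>E\<close> and \<open>F\<close> feed the disturbance into the state equation and
  the filter output; \<open>H\<close>, \<open>J\<close>, \<open>L\<close> produce \<open>z\<close>.
  Half of the margin \<open>\<epsilon>\<close> absorbs the terms mixing \<open>d\<close> with
  \<open>(\<eta>, w)\<close>, the other half the part of \<open>|z|^2 / \<gamma>\<close> due to
  \<open>(\<eta>, w)\<close>.\<close>

lemma perturbed_dissipation: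
  fixes X P :: "real^'s^'s" and Q :: "real^'w^'s" and R :: "real^'s^'y" and S :: "real^'w^'y"
    and M :: "real^'y^'y" and E :: "real^'d^'s" and F :: "real^'d^'y"
    and H :: "real^'s^'z" and J :: "real^'w^'z" and L :: "real^'d^'z"
  assumes X: "symmetric_mat X" and M: "symmetric_mat M"
    and lmi: "neg_def (transpose (lmi_outer P Q R S) ** lmi_middle X M ** lmi_outer P Q R S)"
  obtains \<gamma> where "\<gamma> > 0"
    "\<And>\<eta> w d. 2 * (\<eta> \<bullet> (X *v (P *v \<eta> + Q *v w + E *v d)))
      + (R *v \<eta> + S *v w + F *v d) \<bullet> (M *v (R *v \<eta> + S *v w + F *v d))
      + 1 / \<gamma> * (norm (H *v \<eta> + J *v w + L *v d))\<^sup>2 \<le> \<gamma> * (norm d)\<^sup>2"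
proof -
  obtain \<epsilon> where \<epsilon>: "\<epsilon> > 0"
    "\<And>v. v \<bullet> ((transpose (lmi_outer P Q R S) ** lmi_middle X M ** lmi_outer P Q R S) *v v)
      \<le> - \<epsilon> * (norm v)\<^sup>2"
    using neg_def_uniform[OF lmi] by blast
  define U where "U = hcat R S"
  obtain kE where kE: "kE > 0" "\<And>v. norm ((X ** E) *v v) \<le> kE * norm v"
    using matrix_norm_bound_pos[of "X ** E"] by metis
  obtain kF where kF: "kF > 0" "\<And>v. norm ((M ** F) *v v) \<le> kF * norm v"
    using matrix_norm_bound_pos[of "M ** F"] by metis
  obtain kG where kG: "kG > 0" "\<And>v. norm (F *v v) \<le> kG * norm v"
    using matrix_norm_bound_pos[of F] by metis
  obtain kU where kU: "kU > 0" "\<And>v. norm (U *v v) \<le> kU * norm v"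
    using matrix_norm_bound_pos[of U] by metis
  obtain kH where kH: "kH > 0" "\<And>v. norm (hcat H J *v v) \<le> kH * norm v"
    using matrix_norm_bound_pos[of "hcat H J"] by metis
  obtain kL where kL: "kL > 0" "\<And>v. norm (L *v v) \<le> kL * norm v"
    using matrix_norm_bound_pos[of L] by metis
  \<comment> \<open>Coefficient of the mixed terms \<open>V * \<delta>\<close> that arise through
    \<open>E\<close> and through \<open>F\<close>.\<close>
  define c where "c = 2 * (kE + kU * kF)"
  \<comment> \<open>The summand 1 gives \<open>1 / \<gamma> \<le> 1\<close>, and
    \<open>4 * kH\<^sup>2 / \<epsilon>\<close> gives
    \<open>2 * kH\<^sup>2 / \<gamma> \<le> \<epsilon> / 2\<close>. The others are the coefficients
    of \<open>\<delta>\<^sup>2\<close> left by Young's inequality, by the term quadratic in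
    \<open>F *v d\<close>, and by \<open>L *v d\<close>.\<close>
  define \<gamma> where "\<gamma> = 1 + 4 * kH\<^sup>2 / \<epsilon> + c\<^sup>2 / (2 * \<epsilon>) + kG * kF + 2 * kL\<^sup>2"
  have pos: "0 \<le> 4 * kH\<^sup>2 / \<epsilon>" "0 \<le> c\<^sup>2 / (2 * \<epsilon>)" "0 \<le> kG * kF" "0 \<le> 2 * kL\<^sup>2"
    using \<epsilon>(1) kG(1) kF(1) by auto
  then have \<gamma>1: "\<gamma> \<ge> 1" and \<gamma>H: "4 * kH\<^sup>2 / \<epsilon> \<le> \<gamma>"
    unfolding \<gamma>_def by linarith+
  show thesis
  proof
    show "\<gamma> > 0" using \<gamma>1 by simp
    fix \<eta> :: "real^'s" and w :: "real^'w" and d :: "real^'d"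
    define v where "v = col \<eta> w"
    define V where "V = norm v"
    define \<delta> where "\<delta> = norm d"
    define y where "y = R *v \<eta> + S *v w"
    have nn: "V \<ge> 0" "\<delta> \<ge> 0" by (simp_all add: V_def \<delta>_def)
    have y: "norm y \<le> kU * V"
      using kU(2)[of v] by (simp add: y_def U_def v_def V_def hcat_mult_col)
    have "(norm \<eta>)\<^sup>2 \<le> V\<^sup>2"
      by (simp add: V_def v_def norm_col)
    then have \<eta>: "norm \<eta> \<le> V"
      using nn(1) by (rule power2_le_imp_le)
    have nominal: "2 * (\<eta> \<bullet> (X *v (P *v \<eta> + Q *v w))) + y \<bullet> (M *v y) \<le> - \<epsilon> * V\<^sup>2"
      using \<epsilon>(2)[of v] lmi_quadratic_form[OF X, of \<eta> w P Q R S M]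
      by (simp add: v_def V_def y_def)
    have "\<eta> \<bullet> (X *v (E *v d)) \<le> norm \<eta> * norm ((X ** E) *v d)"
      by (simp add: matrix_vector_mul_assoc norm_cauchy_schwarz)
    also have "\<dots> \<le> V * (kE * \<delta>)"
      using \<eta> kE(2)[of d] by (intro mult_mono) (auto simp: V_def \<delta>_def)
    finally have t1: "\<eta> \<bullet> (X *v (E *v d)) \<le> V * (kE * \<delta>)" .
    have "y \<bullet> (M *v (F *v d)) \<le> norm y * norm ((M ** F) *v d)"
      by (simp add: matrix_vector_mul_assoc norm_cauchy_schwarz)
    also have "\<dots> \<le> (kU * V) * (kF * \<delta>)"
      using y kF(2)[of d] kU(1) by (intro mult_mono) (auto simp: V_def \<delta>_def)
    finally have t2: "y \<bullet> (M *v (F *v d)) \<le> (kU * V) * (kF * \<delta>)" .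
    have "(F *v d) \<bullet> (M *v (F *v d)) \<le> norm (F *v d) * norm ((M ** F) *v d)"
      by (simp add: matrix_vector_mul_assoc norm_cauchy_schwarz)
    also have "\<dots> \<le> (kG * \<delta>) * (kF * \<delta>)"
      using kG(2)[of d] kF(2)[of d] kG(1) by (intro mult_mono) (auto simp: \<delta>_def)
    finally have t3: "(F *v d) \<bullet> (M *v (F *v d)) \<le> kG * kF * \<delta>\<^sup>2"
      by (simp add: power2_eq_square mult_ac)
    have "norm (H *v \<eta> + J *v w + L *v d) \<le> kH * V + kL * \<delta>"
      using kH(2)[of v] kL(2)[of d] norm_triangle_ineq[of "H *v \<eta> + J *v w" "L *v d"]
      by (simp add: v_def V_def \<delta>_def hcat_mult_col)
    then have "(norm (H *v \<eta> + J *v w + L *v d))\<^sup>2 \<le> (kH * V + kL * \<delta>)\<^sup>2"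
      by (intro power_mono) auto
    also have "\<dots> \<le> 2 * (kH * V)\<^sup>2 + 2 * (kL * \<delta>)\<^sup>2"
      using sum_squares_ge_zero[of "kH * V - kL * \<delta>" 0] by (simp add: power2_eq_square algebra_simps)
    finally have "1 / \<gamma> * (norm (H *v \<eta> + J *v w + L *v d))\<^sup>2
        \<le> 1 / \<gamma> * (2 * (kH * V)\<^sup>2 + 2 * (kL * \<delta>)\<^sup>2)"
      using \<gamma>1 by (intro mult_left_mono) auto
    also have "\<dots> = (2 * kH\<^sup>2 / \<gamma>) * V\<^sup>2 + (2 * kL\<^sup>2 / \<gamma>) * \<delta>\<^sup>2"
      by (simp add: power_mult_distrib algebra_simps add_divide_distrib)
    also have "\<dots> \<le> (\<epsilon> / 2) * V\<^sup>2 + (2 * kL\<^sup>2) * \<delta>\<^sup>2"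
    proof (intro add_mono mult_right_mono)
      show "2 * kH\<^sup>2 / \<gamma> \<le> \<epsilon> / 2"
        using \<gamma>H \<gamma>1 \<epsilon>(1) by (simp add: field_simps)
      show "2 * kL\<^sup>2 / \<gamma> \<le> 2 * kL\<^sup>2"
        using \<gamma>1 by (simp add: divide_le_eq mult_le_cancel_left1)
    qed auto
    finally have t4: "1 / \<gamma> * (norm (H *v \<eta> + J *v w + L *v d))\<^sup>2
        \<le> (\<epsilon> / 2) * V\<^sup>2 + (2 * kL\<^sup>2) * \<delta>\<^sup>2" .
    have t5: "V * (c * \<delta>) \<le> \<epsilon> / 2 * V\<^sup>2 + c\<^sup>2 / (2 * \<epsilon>) * \<delta>\<^sup>2"
      using young_ineq[OF \<epsilon>(1), of V "c * \<delta>"] by (simp add: power_mult_distrib)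
    \<comment> \<open>The first two terms only served to make \<open>\<gamma>\<close> large; in the
      final estimate they are nonnegative slack.\<close>
    have t6: "(4 * kH\<^sup>2 / \<epsilon>) * \<delta>\<^sup>2 + \<delta>\<^sup>2 + c\<^sup>2 / (2 * \<epsilon>) * \<delta>\<^sup>2 + kG * kF * \<delta>\<^sup>2 + 2 * kL\<^sup>2 * \<delta>\<^sup>2
        = \<gamma> * \<delta>\<^sup>2"
      by (simp add: \<gamma>_def algebra_simps)
    have t7: "0 \<le> (4 * kH\<^sup>2 / \<epsilon>) * \<delta>\<^sup>2" "0 \<le> \<delta>\<^sup>2"
      using \<epsilon>(1) by auto
    have "2 * (\<eta> \<bullet> (X *v (P *v \<eta> + Q *v w + E *v d))) + (y + F *v d) \<bullet> (M *v (y + F *v d))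
        = (2 * (\<eta> \<bullet> (X *v (P *v \<eta> + Q *v w))) + y \<bullet> (M *v y))
          + 2 * (\<eta> \<bullet> (X *v (E *v d))) + 2 * (y \<bullet> (M *v (F *v d))) + (F *v d) \<bullet> (M *v (F *v d))"
      using symmetric_mat_inner[OF M, of "F *v d" y]
      by (simp add: matrix_vector_right_distrib inner_add_left inner_add_right algebra_simps)
    also have "\<dots> \<le> - \<epsilon> * V\<^sup>2 + V * (c * \<delta>) + kG * kF * \<delta>\<^sup>2"
      using nominal t1 t2 t3 by (simp add: c_def algebra_simps)
    finally show "2 * (\<eta> \<bullet> (X *v (P *v \<eta> + Q *v w + E *v d)))
      + (R *v \<eta> + S *v w + F *v d) \<bullet> (M *v (R *v \<eta> + S *v w + F *v d))
      + 1 / \<gamma> * (norm (H *v \<eta> + J *v w + L *v d))\<^sup>2 \<le> \<gamma> * (norm d)\<^sup>2"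
      using t4 t5 t6 t7 unfolding y_def[symmetric] \<delta>_def[symmetric] by linarith
  qed
qed

section \<open>Square integrable signals\<close>

text \<open>Measurability of \<open>f\<close> is demanded separately, since measurability of its
  squared norm does not imply it.\<close>

definition square_integrable :: "'a measure \<Rightarrow> ('a \<Rightarrow> real^'n) \<Rightarrow> bool" where
  "square_integrable N f \<longleftrightarrow> f \<in> borel_measurable N \<and> integrable N (\<lambda>t. (norm (f t))\<^sup>2)"

lemma square_integrable_measurable:
  "square_integrable N f \<Longrightarrow> f \<in> borel_measurable N"
  by (simp add: square_integrable_def)

lemma square_integrable_norm_le:
  assumes f: "square_integrable N f" and g: "g \<in> borel_measurable N"
    and le: "\<And>t. norm (g t) \<le> c * norm (f t)"
  shows "square_integrable N g"
proof -
  have "integrable N (\<lambda>t. c\<^sup>2 * (norm (f t))\<^sup>2)"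
    using f by (simp add: square_integrable_def)
  then have "integrable N (\<lambda>t. (norm (g t))\<^sup>2)"
  proof (rule Bochner_Integration.integrable_bound)
    show "(\<lambda>t. (norm (g t))\<^sup>2) \<in> borel_measurable N"
      using g by measurable
    have "(norm (g t))\<^sup>2 \<le> c\<^sup>2 * (norm (f t))\<^sup>2" for t
      using le[of t] by (metis norm_ge_zero power_mono power_mult_distrib)
    then show "AE t in N. norm ((norm (g t))\<^sup>2) \<le> norm (c\<^sup>2 * (norm (f t))\<^sup>2)"
      by (simp add: abs_mult)
  qed
  then show ?thesis
    using g by (simp add: square_integrable_def)
qed

lemma square_integrable_matrix_mult:
  assumes "square_integrable N f"
  shows "square_integrable N (\<lambda>t. P *v f t)"
proof -
  obtain K where "\<And>v. norm (P *v v) \<le> K * norm v"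
    using matrix_norm_bound_pos[of P] by metis
  then show ?thesis
    using assms borel_measurable_matrix_vector_mult[of f N P]
    by (intro square_integrable_norm_le[OF assms]) (auto simp: square_integrable_def)
qed

lemma square_integrable_add:
  assumes "square_integrable N f" "square_integrable N g"
  shows "square_integrable N (\<lambda>t. f t + g t)"
proof -
  have [measurable]: "f \<in> borel_measurable N" "g \<in> borel_measurable N"
    using assms by (simp_all add: square_integrable_def)
  have int: "integrable N (\<lambda>t. 2 * (norm (f t))\<^sup>2 + 2 * (norm (g t))\<^sup>2)"
    using assms by (simp add: square_integrable_def)
  have "(norm (f t + g t))\<^sup>2 \<le> 2 * (norm (f t))\<^sup>2 + 2 * (norm (g t))\<^sup>2" for t
    using power_mono[OF norm_triangle_ineq[of "f t" "g t"] norm_ge_zero, of 2]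
      sum_squares_bound[of "norm (f t)" "norm (g t)"]
    by (simp add: power2_sum)
  then have "integrable N (\<lambda>t. (norm (f t + g t))\<^sup>2)"
    by (intro Bochner_Integration.integrable_bound[OF int]) (auto simp: abs_mult)
  then show ?thesis
    by (simp add: square_integrable_def)
qed

lemma square_integrable_col:
  assumes "square_integrable N f" "square_integrable N g"
  shows "square_integrable N (\<lambda>t. col (f t) (g t))"
proof -
  \<comment> \<open>Stacking is a sum of two matrix images, so the closure properties for matrices
    and sums apply.\<close>
  have "col (f t) (g t) = vcat (mat 1) 0 *v f t + vcat 0 (mat 1) *v g t" for t
    by (simp add: vcat_mult_vec col_add)
  then show ?thesis
    using square_integrable_add[OF assms[THEN square_integrable_matrix_mult]] by simp
qed

lemma integrable_inner_square_integrable: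
  assumes "square_integrable N f" "square_integrable N g"
  shows "integrable N (\<lambda>t. f t \<bullet> g t)"
proof -
  have [measurable]: "f \<in> borel_measurable N" "g \<in> borel_measurable N"
    using assms by (simp_all add: square_integrable_def)
  have "integrable N (\<lambda>t. (norm (f t))\<^sup>2 + (norm (g t))\<^sup>2)"
    using assms by (simp add: square_integrable_def)
  then show ?thesis
  proof (rule Bochner_Integration.integrable_bound)
    have "norm (f t \<bullet> g t) \<le> norm ((norm (f t))\<^sup>2 + (norm (g t))\<^sup>2)" for t
      using Cauchy_Schwarz_ineq2[of "f t" "g t"] sum_squares_bound[of "norm (f t)" "norm (g t)"]
        zero_le_power2[of "norm (f t)"] zero_le_power2[of "norm (g t)"]
        mult_nonneg_nonneg[OF norm_ge_zero[of "f t"] norm_ge_zero[of "g t"]]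
      unfolding real_norm_def by linarith
    then show "AE t in N. norm (f t \<bullet> g t) \<le> norm ((norm (f t))\<^sup>2 + (norm (g t))\<^sup>2)"
      by simp
  qed measurable
qed

lemma integrable_square_integrable:
  assumes "finite_measure N" "square_integrable N f"
  shows "integrable N f"
proof -
  interpret finite_measure N by fact
  have [measurable]: "f \<in> borel_measurable N"
    using assms by (simp add: square_integrable_def)
  have "integrable N (\<lambda>t. 1 + (norm (f t))\<^sup>2)"
    using assms by (simp add: square_integrable_def)
  then show ?thesis
  proof (rule Bochner_Integration.integrable_bound)
    have "norm (f t) \<le> norm (1 + (norm (f t))\<^sup>2)" for t
      using sum_squares_bound[of 1 "norm (f t)"] norm_ge_zero[of "f t"]
      by (simp add: abs_of_nonneg del: norm_ge_zero)
    then show "AE t in N. norm (f t) \<le> norm (1 + (norm (f t))\<^sup>2)"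
      by simp
  qed measurable
qed

lemma square_integrable_continuous:
  fixes f :: "real \<Rightarrow> real^'n"
  assumes "continuous_on {a..b} f"
  shows "square_integrable (lebesgue_on {a..b}) f"
proof -
  have "continuous_on {a..b} (\<lambda>t. (norm (f t))\<^sup>2)"
    by (intro continuous_intros assms)
  then have "integrable (lebesgue_on {a..b}) (\<lambda>t. (norm (f t))\<^sup>2)"
    by (rule continuous_imp_integrable_real)
  moreover have "f \<in> borel_measurable (lebesgue_on {a..b})"
    by (rule continuous_imp_measurable_on_sets_lebesgue[OF assms]) simp
  ultimately show ?thesis
    by (simp add: square_integrable_def)
qed

lemma borel_measurable_lebesgue_on_Icc:
  fixes f :: "real \<Rightarrow> 'a::topological_space"
  assumes "f \<in> borel_measurable (lebesgue_on {a..})"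
  shows "f \<in> borel_measurable (lebesgue_on {a..b})"
  by (rule measurable_restrict_mono[OF assms]) auto

lemma L2e_square_integrable:
  assumes "x \<in> L2e"
  shows "square_integrable (lebesgue_on {0..T}) x"
proof -
  \<comment> \<open>\<open>L2e\<close> speaks of positive horizons only; the maximum with 1 admits
    every real \<open>T\<close>.\<close>
  have "set_integrable lebesgue {0..max T 1} (\<lambda>t. x t \<bullet> x t)"
    using assms by (simp add: L2e_def)
  then have "set_integrable lebesgue {0..T} (\<lambda>t. x t \<bullet> x t)"
    by (rule set_integrable_subset) auto
  moreover have "x \<in> borel_measurable (lebesgue_on {0..T})"
    using assms by (intro borel_measurable_lebesgue_on_Icc) (simp add: L2e_def)
  ultimately show ?thesis
    by (simp add: square_integrable_def set_integrable_Icc_iff power2_norm_eq_inner)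
qed

lemma sig_eq_AE_Icc:
  assumes "sig_eq x y"
  shows "AE t in lebesgue_on {0..T}. x t = y t"
  using assms unfolding sig_eq_def
  by (auto simp: AE_restrict_space_iff elim!: eventually_mono)

lemma L2e_col:
  assumes "x \<in> L2e" "y \<in> L2e"
  shows "(\<lambda>t. col (x t) (y t)) \<in> L2e"
proof -
  have "(\<lambda>t. vcat (mat 1) 0 *v x t + vcat 0 (mat 1) *v y t) \<in> borel_measurable (lebesgue_on {0..})"
    using assms by (intro borel_measurable_add borel_measurable_matrix_vector_mult) (auto simp: L2e_def)
  moreover have "(\<lambda>t. vcat (mat 1) 0 *v x t + vcat 0 (mat 1) *v y t) = (\<lambda>t. col (x t) (y t))"
    by (simp add: vcat_mult_vec col_add)
  moreover have "square_integrable (lebesgue_on {0..T}) (\<lambda>t. col (x t) (y t))" for T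
    by (intro square_integrable_col L2e_square_integrable assms)
  ultimately show ?thesis
    by (simp add: L2e_def set_integrable_Icc_iff square_integrable_def power2_norm_eq_inner)
qed

section \<open>State trajectories: uniqueness, existence, change of input on null sets\<close>

lemma state_traj_iff:
  "state_traj A B u x \<longleftrightarrow> continuous_on {0..} x \<and>
    (\<forall>t\<ge>0. x t = integral\<^sup>L (lebesgue_on {0..t}) (\<lambda>s. A *v x s + B *v u s))"
  by (simp add: state_traj_def set_integral_Icc_eq)

lemma state_traj_square_integrable:
  assumes "state_traj A B u x"
  shows "square_integrable (lebesgue_on {0..T}) x"
  using assms unfolding state_traj_def
  by (intro square_integrable_continuous) (auto elim: continuous_on_subset)

lemma integral_lebesgue_on_continuous:
  fixes f :: "real \<Rightarrow> real^'n"
  assumes "continuous_on {a..b} f"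
  shows "integral\<^sup>L (lebesgue_on {a..b}) f = integral {a..b} f"
  using integrable_square_integrable[OF finite_measure_lebesgue_on_Icc
      square_integrable_continuous[OF assms]]
  by (simp add: lebesgue_integral_eq_integral)

lemma L2e_matrix_mult_integrable:
  assumes "u \<in> L2e"
  shows "integrable (lebesgue_on {0..T}) (\<lambda>s. P *v u s)"
  by (intro integrable_square_integrable finite_measure_lebesgue_on_Icc
      square_integrable_matrix_mult L2e_square_integrable assms)

text \<open>Splits off the input as a forcing term and rewrites the continuous state part as a gauge
  integral, the form used in the Volterra equations.\<close>

lemma integral_affine_state:
  assumes x: "continuous_on {0..} x" and u: "u \<in> L2e"
  shows "integral\<^sup>L (lebesgue_on {0..t}) (\<lambda>s. A *v x s + B *v u s)
    = integral\<^sup>L (lebesgue_on {0..t}) (\<lambda>s. B *v u s) + integral {0..t} (\<lambda>s. A *v x s)"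
proof -
  have c: "continuous_on {0..t} (\<lambda>s. A *v x s)"
    by (intro continuous_on_matrix_vector_mult continuous_on_subset[OF x]) auto
  have "integrable (lebesgue_on {0..t}) (\<lambda>s. A *v x s)"
    by (intro integrable_square_integrable finite_measure_lebesgue_on_Icc
        square_integrable_continuous c)
  then show ?thesis
    using integral_lebesgue_on_continuous[OF c] L2e_matrix_mult_integrable[OF u, of t B]
    by simp
qed

text \<open>The input cancels in the difference of two trajectories, which then solves the
  homogeneous Volterra equation. This identifies a given state of \<open>G\<close> with the one
  hidden inside \<open>response\<close>.\<close>

lemma state_traj_unique:
  assumes "u \<in> L2e" "state_traj A B u x" "state_traj A B u y" "0 \<le> t"
  shows "x t = y t"
proof -
  have cx: "continuous_on {0..} x" and cy: "continuous_on {0..} y"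
    using assms by (auto simp: state_traj_iff)
  have "x t - y t = 0"
  proof (rule linear_integral_equation_zero[where e = "\<lambda>t. x t - y t" and P = A])
    show "continuous_on {0..} (\<lambda>t. x t - y t)"
      by (intro continuous_on_diff cx cy)
    fix t :: real assume t: "0 \<le> t"
    have "continuous_on {0..t} (\<lambda>s. A *v x s)" "continuous_on {0..t} (\<lambda>s. A *v y s)"
      by (auto intro!: continuous_on_matrix_vector_mult
          intro: continuous_on_subset[OF cx] continuous_on_subset[OF cy])
    then have i: "(\<lambda>s. A *v x s) integrable_on {0..t}" "(\<lambda>s. A *v y s) integrable_on {0..t}"
      by (auto intro: integrable_continuous_real)
    have "x t - y t = integral {0..t} (\<lambda>s. A *v x s) - integral {0..t} (\<lambda>s. A *v y s)"
      using assms(2,3) t integral_affine_state[OF cx assms(1), of t A B]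
        integral_affine_state[OF cy assms(1), of t A B]
      by (simp add: state_traj_iff)
    also have "\<dots> = integral {0..t} (\<lambda>s. A *v (x s - y s))"
      by (simp add: matrix_vector_mult_diff_distrib integral_diff i)
    finally show "x t - y t = integral {0..t} (\<lambda>s. A *v (x s - y s))" .
  qed (fact \<open>0 \<le> t\<close>)
  then show ?thesis by simp
qed

text \<open>The integrated input is continuous even though the input is only locally square
  integrable, so it can serve as the forcing term of a Volterra equation.\<close>

lemma state_traj_exists:
  assumes u: "u \<in> L2e"
  obtains x where "state_traj A B u x"
proof -
  define g where "g t = integral\<^sup>L (lebesgue_on {0..t}) (\<lambda>s. B *v u s)" for t
  have "continuous_on {0..b} g" for b
  proof -
    have i: "integrable (lebesgue_on {0..t}) (\<lambda>s. B *v u s)" for t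
      by (rule L2e_matrix_mult_integrable[OF u])
    then have "continuous_on {0..b} (\<lambda>t. integral {0..t} (\<lambda>s. B *v u s))"
      by (intro indefinite_integral_continuous_1 integrable_on_lebesgue_on) auto
    moreover have "g t = integral {0..t} (\<lambda>s. B *v u s)" for t
      unfolding g_def using i by (simp add: lebesgue_integral_eq_integral)
    ultimately show ?thesis by (simp add: fun_eq_iff[symmetric])
  qed
  then have "continuous_on {0..} g"
    by (rule continuous_on_atLeast_if_Icc)
  then obtain x where x: "continuous_on {0..} x"
    "\<And>t. 0 \<le> t \<Longrightarrow> x t = g t + integral {0..t} (\<lambda>s. A *v x s)"
    using linear_integral_equation_solution[of g A] by blast
  then have "state_traj A B u x"
    by (simp add: state_traj_iff integral_affine_state[OF x(1) u] g_def)
  then show thesis by (rule that)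
qed

text \<open>Needed because the IQC is stated for the filter input built from
  \<open>\<Delta> z\<close> itself, while a response has \<open>w\<close> equal to
  \<open>\<Delta> z\<close> only almost everywhere.\<close>

lemma state_traj_sig_eq:
  assumes x: "state_traj A B u x" and u: "u \<in> L2e" and v: "v \<in> L2e" and eq: "sig_eq u v"
  shows "state_traj A B v x"
proof -
  have "integral\<^sup>L (lebesgue_on {0..t}) (\<lambda>s. A *v x s + B *v u s)
      = integral\<^sup>L (lebesgue_on {0..t}) (\<lambda>s. A *v x s + B *v v s)" for t
  proof (rule integral_cong_AE)
    show "AE s in lebesgue_on {0..t}. A *v x s + B *v u s = A *v x s + B *v v s"
      using sig_eq_AE_Icc[OF eq, of t] by (auto elim!: eventually_mono)
  qed (intro borel_measurable_add borel_measurable_matrix_vector_mult square_integrable_measurable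
      state_traj_square_integrable[OF x] L2e_square_integrable u v)+
  then show ?thesis
    using x by (simp add: state_traj_iff)
qed

section \<open>The interconnection as one linear system with inputs \<open>w\<close> and
  \<open>d\<close>\<close>

lemma integral_col:
  assumes "integrable N f" "integrable N g"
  shows "integral\<^sup>L N (\<lambda>t. col (f t) (g t)) = col (integral\<^sup>L N f) (integral\<^sup>L N g)"
proof -
  have eq: "col a b = vcat (mat 1) 0 *v a + vcat 0 (mat 1) *v b" for a :: "real^'b" and b :: "real^'c"
    by (simp add: vcat_mult_vec col_add)
  show "integral\<^sup>L N (\<lambda>t. col (f t) (g t)) = col (integral\<^sup>L N f) (integral\<^sup>L N g)"
    unfolding eq by (simp add: matrix_vector_mult_integral assms)
qed

text \<open>With \<open>a = C x\<close>, \<open>b = D w\<close>, \<open>c = d\<close> the three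
  summands are the contributions through \<open>CF C\<close>, \<open>DF D\<close> and
  \<open>CF (mat 1)\<close>.\<close>

lemma mult_col_split:
  "P *v col (a + b + c) w = P *v col a 0 + P *v col b w + P *v col c 0"
  by (simp add: matrix_vector_right_distrib[symmetric] col_add)

text \<open>The disturbance acts on the filter through the same channel as \<open>C *v x\<close>,
  and not on the state of \<open>G\<close>; hence its input matrix
  \<open>vcat (B\<Psi> ** CF (mat 1)) 0\<close>.\<close>

lemma interconnection_state:
  "col (A\<Psi> *v \<xi> + B\<Psi> *v col (C *v x + D *v w + d) w) (A *v x + B *v w)
    = calA A\<Psi> B\<Psi> A C *v col \<xi> x + calB B\<Psi> B D *v w + vcat (B\<Psi> ** CF (mat 1)) 0 *v d"
  unfolding mult_col_split
  by (simp add: calA_def calB_def vcat_mult_vec hcat_mult_col CF_mult_vec DF_mult_vec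
      matrix_vector_mul_assoc[symmetric] col_add add.assoc)

lemma interconnection_output:
  "C\<Psi> *v \<xi> + D\<Psi> *v col (C *v x + D *v w + d) w
    = calC C\<Psi> D\<Psi> C *v col \<xi> x + calD D\<Psi> D *v w + (D\<Psi> ** CF (mat 1)) *v d"
  unfolding mult_col_split
  by (simp add: calC_def calD_def hcat_mult_col CF_mult_vec DF_mult_vec
      matrix_vector_mul_assoc[symmetric] add.assoc)

section \<open>Norms on the half-line versus integrals over compact intervals\<close>

lemma L2_integral_Icc_le:
  assumes "x \<in> L2"
  shows "integral\<^sup>L (lebesgue_on {0..T}) (\<lambda>t. (norm (x t))\<^sup>2) \<le> (L2_norm x)\<^sup>2"
proof -
  have i: "integrable lebesgue (\<lambda>t. indicator {0..} t *\<^sub>R (norm (x t))\<^sup>2)"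
    using assms by (simp add: L2_def set_integrable_def power2_norm_eq_inner)
  have "integral\<^sup>L (lebesgue_on {0..T}) (\<lambda>t. (norm (x t))\<^sup>2)
      = (\<integral>t. indicator {0..T} t *\<^sub>R (norm (x t))\<^sup>2 \<partial>lebesgue)"
    by (simp add: integral_restrict_space)
  also have "\<dots> \<le> (\<integral>t. indicator {0..} t *\<^sub>R (norm (x t))\<^sup>2 \<partial>lebesgue)"
    by (rule integral_mono'[OF i]) (auto simp: indicator_def)
  also have "\<dots> = (L2_norm x)\<^sup>2"
    by (simp add: L2_norm_def set_lebesgue_integral_def power2_norm_eq_inner
        Bochner_Integration.integral_nonneg)
  finally show ?thesis .
qed

text \<open>Monotone convergence along the horizons \<open>T = n\<close>: the truncated energies
  increase and are bounded, so the limit is integrable with the same bound.\<close>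

lemma L2_if_bounded_on_Icc:
  assumes x: "x \<in> L2e" and c: "c \<ge> 0"
    and bnd: "\<And>T. T > 0 \<Longrightarrow> integral\<^sup>L (lebesgue_on {0..T}) (\<lambda>t. (norm (x t))\<^sup>2) \<le> c\<^sup>2"
  shows "x \<in> L2" and "L2_norm x \<le> c"
proof -
  define f where "f n t = indicator {0..real n} t *\<^sub>R (norm (x t))\<^sup>2" for n t
  define g where "g t = indicator {0..} t *\<^sub>R (norm (x t))\<^sup>2" for t
  have f_int: "integrable lebesgue (f n)" for n
    using L2e_square_integrable[OF x, of n]
    by (simp add: f_def[abs_def] square_integrable_def integrable_restrict_space)
  have f_eq: "integral\<^sup>L lebesgue (f n) = integral\<^sup>L (lebesgue_on {0..real n}) (\<lambda>t. (norm (x t))\<^sup>2)" for n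
    by (simp add: f_def[abs_def] integral_restrict_space)
  have f_mono: "f m t \<le> f n t" if "m \<le> n" for m n t
    using that by (auto simp: f_def indicator_def)
  have f_bnd: "integral\<^sup>L lebesgue (f n) \<le> c\<^sup>2" for n
  proof -
    \<comment> \<open>The hypothesis excludes the horizon 0, so \<open>n\<close> is compared with
      \<open>Suc n\<close>.\<close>
    have "integral\<^sup>L lebesgue (f n) \<le> integral\<^sup>L lebesgue (f (Suc n))"
      by (intro integral_mono f_int f_mono) simp
    also have "\<dots> \<le> c\<^sup>2"
      unfolding f_eq by (intro bnd) simp
    finally show ?thesis .
  qed
  have "incseq (\<lambda>n. integral\<^sup>L lebesgue (f n))"
    by (intro incseq_SucI integral_mono f_int f_mono) simp
  then obtain L where L: "(\<lambda>n. integral\<^sup>L lebesgue (f n)) \<longlonglongrightarrow> L"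
    using f_bnd by (blast intro: incseq_convergent)
  have L_le: "L \<le> c\<^sup>2"
    by (rule LIMSEQ_le_const2[OF L]) (use f_bnd in auto)
  have lim: "(\<lambda>n. f n t) \<longlonglongrightarrow> g t" for t
  proof (rule tendsto_eventually)
    show "\<forall>\<^sub>F n in sequentially. f n t = g t"
      using eventually_ge_at_top[of "nat \<lceil>t\<rceil>"]
      by eventually_elim (auto simp: f_def g_def indicator_def nat_le_iff ceiling_le_iff)
  qed
  have g_meas: "g \<in> borel_measurable lebesgue"
    by (rule borel_measurable_LIMSEQ_real[OF lim]) (use f_int in auto)
  have "integrable lebesgue g" and g_eq: "integral\<^sup>L lebesgue g = L"
    using integrable_monotone_convergence[OF f_int _ _ L g_meas]
      integral_monotone_convergence[OF f_int _ _ L g_meas] f_mono lim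
    by (auto simp: mono_def)
  then show "x \<in> L2"
    using x by (simp add: L2_def g_def[abs_def] set_integrable_def power2_norm_eq_inner)
  have "L2_norm x = sqrt (integral\<^sup>L lebesgue g)"
    by (simp add: L2_norm_def set_lebesgue_integral_def power2_norm_eq_inner g_def[abs_def])
  also have "\<dots> \<le> sqrt (c\<^sup>2)"
    unfolding g_eq using L_le by (rule real_sqrt_le_mono)
  finally show "L2_norm x \<le> c"
    using c by simp
qed

section \<open>Dissipation inequality and gain bound along responses\<close>

theorem theorem4:
  fixes A :: "real^'n^'n" and B :: "real^'w^'n" and C :: "real^'n^'z" and D :: "real^'w^'z"
    and A\<Psi> :: "real^'k^'k" and B\<Psi> :: "real^('z::finite + 'w::finite)^'k"
    and C\<Psi> :: "real^'k^'y" and D\<Psi> :: "real^('z::finite + 'w::finite)^'y"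
    and M :: "real^'y^'y" and Z :: "real^'k^'k"
    and X :: "real^('k::finite + 'n::finite)^('k + 'n)"
    and \<Delta> :: "(real \<Rightarrow> real^'z) \<Rightarrow> (real \<Rightarrow> real^'w)"
  assumes "hurwitz A\<Psi>"
    and "symmetric_mat M"
    and "symmetric_mat Z"
    and "system_on_L2e \<Delta>"
    and "causal \<Delta>"
    and "finite_horizon_iqc A\<Psi> B\<Psi> C\<Psi> D\<Psi> M Z \<Delta>"
    and "symmetric_mat X"
    and "neg_def
           (transpose (lmi_outer (calA A\<Psi> B\<Psi> A C) (calB B\<Psi> B D) (calC C\<Psi> D\<Psi> C) (calD D\<Psi> D))
            ** lmi_middle X M
            ** lmi_outer (calA A\<Psi> B\<Psi> A C) (calB B\<Psi> B D) (calC C\<Psi> D\<Psi> C) (calD D\<Psi> D))"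
    and "pos_def (coupling X Z)"
  shows "\<exists>\<gamma>>0.
    (\<forall>d\<in>L2e. \<forall>z w \<xi> x.
       response A B C D \<Delta> d z w \<longrightarrow>
       state_traj A\<Psi> B\<Psi> (\<lambda>t. col (z t) (w t)) \<xi> \<longrightarrow>
       state_traj A B w x \<longrightarrow>
       (\<forall>T>0. col (\<xi> T) (x T) \<bullet> (coupling X Z *v col (\<xi> T) (x T))
              + (LINT t:{0..T}|lebesgue. 1 / \<gamma> * (norm (z t))\<^sup>2 - \<gamma> * (norm (d t))\<^sup>2) \<le> 0)) \<and>
    (\<forall>d\<in>L2. \<forall>z w.
       response A B C D \<Delta> d z w \<longrightarrow> z \<in> L2 \<and> L2_norm z \<le> \<gamma> * L2_norm d)"
proof -
  \<comment> \<open>The last norm is that of \<open>z = C x + D w + d\<close>, with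
    \<open>hcat 0 C\<close> reading \<open>x\<close> off the joint state. The constant depends on
    the matrices only, hence serves all disturbances and responses.\<close>
  obtain \<gamma> where \<gamma>: "\<gamma> > 0" and diss: "\<And>\<eta> w d.
      2 * (\<eta> \<bullet> (X *v (calA A\<Psi> B\<Psi> A C *v \<eta> + calB B\<Psi> B D *v w + vcat (B\<Psi> ** CF (mat 1)) 0 *v d)))
      + (calC C\<Psi> D\<Psi> C *v \<eta> + calD D\<Psi> D *v w + (D\<Psi> ** CF (mat 1)) *v d)
          \<bullet> (M *v (calC C\<Psi> D\<Psi> C *v \<eta> + calD D\<Psi> D *v w + (D\<Psi> ** CF (mat 1)) *v d))
      + 1 / \<gamma> * (norm (hcat 0 C *v \<eta> + D *v w + mat 1 *v d))\<^sup>2 \<le> \<gamma> * (norm d)\<^sup>2"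
    using perturbed_dissipation[OF assms(7,2,8), of "vcat (B\<Psi> ** CF (mat 1)) 0"
        "D\<Psi> ** CF (mat 1)" "hcat 0 C" D "mat 1"] by blast
  have storage: "col (\<xi> T) (x T) \<bullet> (coupling X Z *v col (\<xi> T) (x T))
      + (LINT t:{0..T}|lebesgue. 1 / \<gamma> * (norm (z t))\<^sup>2 - \<gamma> * (norm (d t))\<^sup>2) \<le> 0"
    if d: "d \<in> L2e" and resp: "response A B C D \<Delta> d z w"
      and \<xi>: "state_traj A\<Psi> B\<Psi> (\<lambda>t. col (z t) (w t)) \<xi>" and x: "state_traj A B w x" and T: "T > 0"
    for d z w \<xi> x and T :: real
  proof -
    have z: "z \<in> L2e" and w: "w \<in> L2e" and w\<Delta>: "sig_eq w (\<Delta> z)"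
      using resp by (auto simp: response_def)
    obtain v x' where x': "state_traj A B w x'" and v: "sig_eq v (\<lambda>t. C *v x' t + D *v w t)"
      and zv: "sig_eq z (\<lambda>t. v t + d t)"
      using resp by (auto simp: response_def lti_output_def)
    define N where "N = lebesgue_on {0..T}"
    have fin: "finite_measure N"
      unfolding N_def by (rule finite_measure_lebesgue_on_Icc)
    \<comment> \<open>\<open>AE_space\<close> supplies \<open>t \<ge> 0\<close>, where uniqueness
      allows \<open>x'\<close> to be replaced by \<open>x\<close>.\<close>
    have z_eq: "AE t in N. z t = C *v x t + D *v w t + d t"
      using AE_space sig_eq_AE_Icc[OF v, of T, folded N_def] sig_eq_AE_Icc[OF zv, of T, folded N_def]
      by eventually_elim (use state_traj_unique[OF w x' x] in \<open>simp add: N_def\<close>)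
    define u where "u t = col (z t) (w t)" for t
    define \<eta> where "\<eta> t = col (\<xi> t) (x t)" for t
    define p where "p t = col (A\<Psi> *v \<xi> t + B\<Psi> *v u t) (A *v x t + B *v w t)" for t
    define y where "y t = C\<Psi> *v \<xi> t + D\<Psi> *v u t" for t
    have sq: "square_integrable (lebesgue_on {0..t}) z" "square_integrable (lebesgue_on {0..t}) w"
      "square_integrable (lebesgue_on {0..t}) d" "square_integrable (lebesgue_on {0..t}) \<xi>"
      "square_integrable (lebesgue_on {0..t}) x" for t
      by (intro L2e_square_integrable state_traj_square_integrable[OF \<xi>]
          state_traj_square_integrable[OF x] z w d)+
    have u_sq: "square_integrable (lebesgue_on {0..t}) u" for t
      unfolding u_def by (intro square_integrable_col sq)
    have p_parts: "square_integrable (lebesgue_on {0..t}) (\<lambda>t. A\<Psi> *v \<xi> t + B\<Psi> *v u t)"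
      "square_integrable (lebesgue_on {0..t}) (\<lambda>t. A *v x t + B *v w t)" for t
      by (intro square_integrable_add square_integrable_matrix_mult sq u_sq)+
    have p_sq: "square_integrable N p" and \<eta>_sq: "square_integrable N \<eta>"
      unfolding p_def \<eta>_def N_def by (intro square_integrable_col p_parts sq)+
    have y_sq: "square_integrable N y"
      unfolding y_def N_def by (intro square_integrable_add square_integrable_matrix_mult sq u_sq)
    have "\<eta> t = integral\<^sup>L (lebesgue_on {0..t}) p" if "0 \<le> t" for t
      using that \<xi> x integral_col[OF
          integrable_square_integrable[OF finite_measure_lebesgue_on_Icc p_parts(1)]
          integrable_square_integrable[OF finite_measure_lebesgue_on_Icc p_parts(2)], of t]
      by (simp add: \<eta>_def p_def[abs_def] state_traj_iff u_def[abs_def])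
    \<comment> \<open>\<open>p\<close> is the derivative of \<open>\<eta>\<close>, and
      \<open>\<eta>\<close> vanishes at time 0, so only the storage at time \<open>T\<close>
      remains.\<close>
    then have energy: "(\<integral>t. 2 * (\<eta> t \<bullet> (X *v p t)) \<partial>N) = \<eta> T \<bullet> (X *v \<eta> T)"
      using T integrable_square_integrable[OF fin p_sq] unfolding N_def
      by (intro quadratic_form_indefinite_integral assms) auto
    \<comment> \<open>The IQC is applied to the input \<open>u'\<close> containing
      \<open>\<Delta> z\<close>, and then transferred to \<open>u\<close>: the same
      \<open>\<xi>\<close> is a trajectory for both, and the outputs agree almost
      everywhere.\<close>
    have iqc: "0 \<le> (\<integral>t. y t \<bullet> (M *v y t) \<partial>N) + \<xi> T \<bullet> (Z *v \<xi> T)"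
    proof -
      define u' where "u' t = col (z t) (\<Delta> z t)" for t
      define y' where "y' t = C\<Psi> *v \<xi> t + D\<Psi> *v u' t" for t
      have "\<Delta> z \<in> L2e"
        using assms(4) z by (simp add: system_on_L2e_def)
      then have u': "u' \<in> L2e" and u: "u \<in> L2e"
        unfolding u'_def u_def by (intro L2e_col z w; simp)+
      have uu': "sig_eq u u'"
        using w\<Delta> by (auto simp: sig_eq_def u_def u'_def elim!: eventually_mono)
      have "state_traj A\<Psi> B\<Psi> u' \<xi>"
        using \<xi> by (intro state_traj_sig_eq[OF _ u u' uu']) (simp add: u_def[abs_def])
      then have "0 \<le> (LINT t:{0..T}|lebesgue. y' t \<bullet> (M *v y' t)) + \<xi> T \<bullet> (Z *v \<xi> T)"
        using assms(6) z T unfolding finite_horizon_iqc_def u'_def[abs_def] y'_def[abs_def] by blast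
      moreover have "(\<integral>t. y' t \<bullet> (M *v y' t) \<partial>N) = (\<integral>t. y t \<bullet> (M *v y t) \<partial>N)"
      proof (rule integral_cong_AE)
        have y'_sq: "square_integrable N y'"
          unfolding y'_def N_def
          by (intro square_integrable_add square_integrable_matrix_mult sq L2e_square_integrable u')
        show "(\<lambda>t. y' t \<bullet> (M *v y' t)) \<in> borel_measurable N" "(\<lambda>t. y t \<bullet> (M *v y t)) \<in> borel_measurable N"
          by (intro borel_measurable_integrable integrable_inner_square_integrable
              square_integrable_matrix_mult y_sq y'_sq)+
        show "AE t in N. y' t \<bullet> (M *v y' t) = y t \<bullet> (M *v y t)"
          using sig_eq_AE_Icc[OF uu', of T] unfolding N_def
          by eventually_elim (simp add: y_def y'_def)
      qed
      ultimately show ?thesis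
        by (simp add: set_integral_Icc_eq N_def)
    qed
    have ints: "integrable N (\<lambda>t. 2 * (\<eta> t \<bullet> (X *v p t)))" "integrable N (\<lambda>t. y t \<bullet> (M *v y t))"
      by (intro integrable_mult_right integrable_inner_square_integrable
          square_integrable_matrix_mult p_sq y_sq \<eta>_sq)+
    have int_zd: "integrable N (\<lambda>t. 1 / \<gamma> * (norm (z t))\<^sup>2 - \<gamma> * (norm (d t))\<^sup>2)"
      using sq[of T] by (simp add: square_integrable_def N_def)
    \<comment> \<open>The dissipation bound at each time where the loop equation for
      \<open>z\<close> holds.\<close>
    have "AE t in N. 2 * (\<eta> t \<bullet> (X *v p t)) + y t \<bullet> (M *v y t)
        + (1 / \<gamma> * (norm (z t))\<^sup>2 - \<gamma> * (norm (d t))\<^sup>2) \<le> 0"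
      using z_eq
    proof eventually_elim
      case (elim t)
      show ?case
        using diss[of "\<eta> t" "w t" "d t"]
        unfolding \<eta>_def p_def y_def u_def elim interconnection_state
        unfolding interconnection_output by (simp add: hcat_mult_col)
    qed
    then have "(\<integral>t. 2 * (\<eta> t \<bullet> (X *v p t)) + y t \<bullet> (M *v y t)
        + (1 / \<gamma> * (norm (z t))\<^sup>2 - \<gamma> * (norm (d t))\<^sup>2) \<partial>N) \<le> (\<integral>t. 0 \<partial>N)"
      by (intro integral_mono_AE Bochner_Integration.integrable_add ints int_zd) auto
    then have "\<eta> T \<bullet> (X *v \<eta> T) + (\<integral>t. y t \<bullet> (M *v y t) \<partial>N)
        + (\<integral>t. 1 / \<gamma> * (norm (z t))\<^sup>2 - \<gamma> * (norm (d t))\<^sup>2 \<partial>N) \<le> 0"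
      by (simp only: Bochner_Integration.integral_add Bochner_Integration.integrable_add ints int_zd
          energy integral_zero)
    then show ?thesis
      using iqc unfolding coupling_quadratic_form set_integral_Icc_eq N_def \<eta>_def by linarith
  qed
  have gain: "z \<in> L2 \<and> L2_norm z \<le> \<gamma> * L2_norm d"
    if d: "d \<in> L2" and resp: "response A B C D \<Delta> d z w" for d z w
  proof -
    have d': "d \<in> L2e" using d by (simp add: L2_def)
    have z: "z \<in> L2e" and w: "w \<in> L2e"
      using resp by (auto simp: response_def)
    obtain x where x: "state_traj A B w x"
      using resp by (auto simp: response_def lti_output_def)
    \<comment> \<open>A response carries a state of \<open>G\<close> but none of the filter, so one
      is constructed to make \<open>storage\<close> applicable.\<close>
    obtain \<xi> where \<xi>: "state_traj A\<Psi> B\<Psi> (\<lambda>t. col (z t) (w t)) \<xi>"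
      using state_traj_exists[OF L2e_col[OF z w]] by blast
    have nn: "0 \<le> L2_norm d"
      by (simp add: L2_norm_def set_lebesgue_integral_def Bochner_Integration.integral_nonneg)
    have "(\<integral>t. (norm (z t))\<^sup>2 \<partial>lebesgue_on {0..T}) \<le> (\<gamma> * L2_norm d)\<^sup>2" if T: "T > 0" for T
    proof -
      let ?N = "lebesgue_on {0..T}"
      have "0 \<le> v \<bullet> (coupling X Z *v v)" for v
        using assms(9) by (cases "v = 0") (auto simp: pos_def_def less_imp_le)
      \<comment> \<open>Positivity of the coupling matrix lets the terminal storage be
        dropped.\<close>
      then have "(\<integral>t. 1 / \<gamma> * (norm (z t))\<^sup>2 - \<gamma> * (norm (d t))\<^sup>2 \<partial>?N) \<le> 0"
        using storage[OF d' resp \<xi> x T] unfolding set_integral_Icc_eq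
        by (meson add_increasing dual_order.trans order_refl)
      moreover have "integrable ?N (\<lambda>t. (norm (z t))\<^sup>2)" "integrable ?N (\<lambda>t. (norm (d t))\<^sup>2)"
        using L2e_square_integrable[OF z] L2e_square_integrable[OF d']
        by (simp_all add: square_integrable_def)
      ultimately have "(\<integral>t. (norm (z t))\<^sup>2 \<partial>?N) / \<gamma> \<le> \<gamma> * (\<integral>t. (norm (d t))\<^sup>2 \<partial>?N)"
        by simp
      also have "\<dots> \<le> \<gamma> * (L2_norm d)\<^sup>2"
        using \<gamma> L2_integral_Icc_le[OF d] by simp
      finally show ?thesis
        using \<gamma> by (simp add: field_simps power2_eq_square)
    qed
    then show ?thesis
      using L2_if_bounded_on_Icc[OF z, of "\<gamma> * L2_norm d"] \<gamma> nn by simp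
  qed
  show ?thesis
    using \<gamma> storage gain by blast
qed

end
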